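(* For every small walled wedge whose induced subgraph of the grid is connected, there exists a finite deterministic automaton that explores it using no pebbles (i.e., with $p=0$).
   Context: The oriented grid $\mathbb{Z}\times\mathbb{Z}$ is embedded in the plane (nodes at integer points, edges between nodes at distance 1); nodes are anonymous and every node has ports $N,E,S,W$ pointing North, East, South, West. Given two half-lines $H_1,H_2$ in the plane with a common origin $O$ (an arbitrary point; the directions are arbitrary real unit vectors), let $W(H_1,H_2)$ be the closed region of the plane swept clockwise from $H_1$ to $H_2$ (both half-lines included). The wedge is the subgraph of the grid induced by the grid nodes in $W(H_1,H_2)$. If the clockwise angle from $H_1$ to $H_2$ is $\alpha\in(0,2\pi]$, the wedge is an $\alpha$-wedge; it is small if $\alpha<\pi$ and large if $\alpha\ge\pi$. A boundary $H_i$ is a wall if for every grid edge $\{u,v\}$ with $u$ in the wedge, $v$ not in the wedge and $H_i$ meeting the closed segment $[u,v]$, the ports of this edge at $u$ and at $v$ are blocked (cannot be taken); all other ports are free. A wedge is walled if both $H_1$ and $H_2$ are walls. The agent is a finite deterministic (Mealy) automaton carrying $p$ pebbles: at each step, at its current node, it sees which ports are free, whether a pebble lies on the node, and how many pebbles it carries; depending on its state and this input it moves through a free port, possibly dropping a pebble on the empty current node (if it carries one) or picking up the pebble lying there, and changes state. It starts in its initial state, carrying all $p$ pebbles, with no pebbles on the grid, at a node of the wedge chosen by an adversary. The automaton (which may depend on $H_1,H_2$ but not on the starting node) explores the wedge if, for every starting node in the wedge, every node of the wedge is eventually visited. *)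

theory Defs
  imports "HOL-Analysis.Analysis" "Graph_Theory.Digraph_Component"
begin

type_synonym node = "int \<times> int"

datatype port = North | East | South | West

fun neighbor :: "node \<Rightarrow> port \<Rightarrow> node" where
  "neighbor (x, y) North = (x, y + 1)"
| "neighbor (x, y) East = (x + 1, y)"
| "neighbor (x, y) South = (x, y - 1)"
| "neighbor (x, y) West = (x - 1, y)"

text \<open>The plane is the type of complex numbers: East is \<open>1\<close>, North is the imaginary unit.\<close>

definition point :: "node \<Rightarrow> complex" where
  "point v = Complex (of_int (fst v)) (of_int (snd v))"

text \<open>An undirected edge is represented by its two orientations.\<close>

definition grid :: "node pair_pre_digraph" where
  "grid = \<lparr> pverts = UNIV, parcs = {(u, v). dist (point u) (point v) = 1} \<rparr>"

lemma grid_arc_iff: "(u, v) \<in> parcs grid \<longleftrightarrow> (\<exists>d. v = neighbor u d)"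
proof
  assume "(u, v) \<in> parcs grid"
  obtain a b c e where [simp]: "u = (a, b)" "v = (c, e)"
    by (cases u, cases v)
  have "(real_of_int a - real_of_int c)\<^sup>2 + (real_of_int b - real_of_int e)\<^sup>2 = 1"
    using \<open>(u, v) \<in> parcs grid\<close> by (simp add: grid_def point_def dist_norm cmod_def)
  then have eq: "(a - c)\<^sup>2 + (b - e)\<^sup>2 = (1::int)"
    by (metis (no_types, opaque_lifting) of_int_1 of_int_add of_int_diff of_int_eq_iff of_int_power)
  have "(a - c)\<^sup>2 \<le> 1\<^sup>2" "(b - e)\<^sup>2 \<le> 1\<^sup>2"
    using eq zero_le_power2[of "a - c"] zero_le_power2[of "b - e"]
    unfolding power_one by linarith+
  then have "\<bar>a - c\<bar> \<le> 1" "\<bar>b - e\<bar> \<le> 1"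
    by (simp_all add: power2_le_iff_abs_le abs_square_le_1)
  then have "a - c \<in> {-1, 0, 1}" "b - e \<in> {-1, 0, 1}"
    by auto
  with eq consider "c = a" "e = b + 1" | "c = a + 1" "e = b" | "c = a" "e = b - 1"
    | "c = a - 1" "e = b"
    by auto
  then show "\<exists>d. v = neighbor u d"
  proof cases
    case 1 then show ?thesis by (intro exI[of _ North]) simp
  next
    case 2 then show ?thesis by (intro exI[of _ East]) simp
  next
    case 3 then show ?thesis by (intro exI[of _ South]) simp
  next
    case 4 then show ?thesis by (intro exI[of _ West]) simp
  qed
next
  assume "\<exists>d. v = neighbor u d"
  then obtain d where "v = neighbor u d" ..
  then show "(u, v) \<in> parcs grid"
    by (cases u; cases d) (simp_all add: grid_def point_def dist_norm cmod_def)
qed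

text \<open>Half-lines are given by their origin \<open>a\<close> and a direction, a complex number of norm 1.\<close>

definition half_line :: "complex \<Rightarrow> complex \<Rightarrow> complex set" where
  "half_line a d = {a + of_real t * d | t. t \<ge> 0}"

text \<open>
  \<open>Arg2pi\<close> measures counterclockwise angles and ranges over \<open>[0, 2\<pi>)\<close>, so the clockwise angle
  ranges over \<open>(0, 2\<pi>]\<close>; equal directions are at clockwise angle \<open>2\<pi>\<close>.
\<close>

definition cw_angle :: "complex \<Rightarrow> complex \<Rightarrow> real" where
  "cw_angle d1 d2 = 2 * pi - Arg2pi (d2 / d1)"

lemma cw_angle_unique:
  assumes "norm d1 = 1" "norm d2 = 1"
  shows "cw_angle d1 d2 = \<alpha> \<longleftrightarrow> 0 < \<alpha> \<and> \<alpha> \<le> 2 * pi \<and> d2 = d1 * cis (- \<alpha>)"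
proof -
  have nz: "d1 \<noteq> 0" using assms(1) by auto
  have n1: "norm (d2 / d1) = 1" using assms by (simp add: norm_divide)
  have per: "cis (2 * pi - \<beta>) = cis (- \<beta>)" for \<beta>
    by (simp add: complex_eq_iff)
  have ex: "d2 / d1 = cis (Arg2pi (d2 / d1))"
    using Arg2pi_eq[of "d2 / d1"] n1 by (simp only: cis_conv_exp of_real_1 mult_1)
  show ?thesis
  proof
    assume "cw_angle d1 d2 = \<alpha>"
    then have A: "Arg2pi (d2 / d1) = 2 * pi - \<alpha>" by (simp add: cw_angle_def)
    then have "d2 / d1 = cis (- \<alpha>)" using ex per by simp
    then have "d2 = d1 * cis (- \<alpha>)" using nz by (simp add: field_simps)
    moreover have "0 < \<alpha>" "\<alpha> \<le> 2 * pi"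
      using Arg2pi_lt_2pi[of "d2 / d1"] Arg2pi_ge_0[of "d2 / d1"] A by simp_all
    ultimately show "0 < \<alpha> \<and> \<alpha> \<le> 2 * pi \<and> d2 = d1 * cis (- \<alpha>)" by simp
  next
    assume a: "0 < \<alpha> \<and> \<alpha> \<le> 2 * pi \<and> d2 = d1 * cis (- \<alpha>)"
    have "d2 / d1 = cis (2 * pi - \<alpha>)"
      using a nz per by simp
    then have "Arg2pi (d2 / d1) = 2 * pi - \<alpha>"
      using a by (intro Arg2pi_unique[of 1]) (simp_all add: cis_conv_exp)
    then show "cw_angle d1 d2 = \<alpha>" by (simp add: cw_angle_def)
  qed
qed

definition wedge_region :: "complex \<Rightarrow> complex \<Rightarrow> complex \<Rightarrow> complex set" where
  "wedge_region a d1 d2 =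
     {a + of_real t * (d1 * cis (- \<theta>)) | t \<theta>. t \<ge> 0 \<and> 0 \<le> \<theta> \<and> \<theta> \<le> cw_angle d1 d2}"

definition wedge_nodes :: "complex \<Rightarrow> complex \<Rightarrow> complex \<Rightarrow> node set" where
  "wedge_nodes a d1 d2 = {v. point v \<in> wedge_region a d1 d2}"

definition wedge_graph :: "complex \<Rightarrow> complex \<Rightarrow> complex \<Rightarrow> (node, node \<times> node) pre_digraph" where
  "wedge_graph a d1 d2 = with_proj grid \<restriction> wedge_nodes a d1 d2"

definition small_wedge :: "complex \<Rightarrow> complex \<Rightarrow> bool" where
  "small_wedge d1 d2 \<longleftrightarrow> cw_angle d1 d2 < pi"

text \<open>
  \<open>walls\<close> is the set of those boundary half-lines that are walls. An edge with exactly one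
  endpoint in the node set \<open>V\<close> is blocked, at both of its endpoints, if it meets a wall.
\<close>

definition blocked_edge :: "node set \<Rightarrow> complex set set \<Rightarrow> node \<Rightarrow> node \<Rightarrow> bool" where
  "blocked_edge V walls u v \<longleftrightarrow>
     (u \<in> V \<and> v \<notin> V \<or> v \<in> V \<and> u \<notin> V) \<and>
     (\<exists>H\<in>walls. H \<inter> closed_segment (point u) (point v) \<noteq> {})"

definition free_ports :: "node set \<Rightarrow> complex set set \<Rightarrow> node \<Rightarrow> port set" where
  "free_ports V walls u = {d. \<not> blocked_edge V walls u (neighbor u d)}"

definition walled_free_ports :: "complex \<Rightarrow> complex \<Rightarrow> complex \<Rightarrow> node \<Rightarrow> port set" where
  "walled_free_ports a d1 d2 =
     free_ports (wedge_nodes a d1 d2) {half_line a d1, half_line a d2}"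

datatype pebble_action = Keep | Drop | Pick

text \<open>
  The input of a transition consists of the set of free ports, the presence of a pebble on the
  current node, and the number of pebbles carried; the output consists of what to do with a
  pebble at the current node and of the port to be taken afterwards.
\<close>

record 's automaton =
  states :: "'s set"
  init :: 's
  trans :: "'s \<Rightarrow> port set \<Rightarrow> bool \<Rightarrow> nat \<Rightarrow> 's \<times> pebble_action \<times> port"

text \<open>
  Transitions are only legal if the chosen port is free (when there is a free port at all), a
  pebble is dropped only if one is carried and the node is empty, and a pebble is picked up only
  if there is one. As the set of states is finite, states of type \<open>nat\<close> suffice for every
  automaton.
\<close>

definition pebble_automaton :: "nat \<Rightarrow> 's automaton \<Rightarrow> bool" where
  "pebble_automaton p A \<longleftrightarrow>
     finite (states A) \<and> init A \<in> states A \<and>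
     (\<forall>q\<in>states A. \<forall>F b c. c \<le> p \<longrightarrow>
       (case trans A q F b c of (q', act, d) \<Rightarrow>
          q' \<in> states A \<and> (F \<noteq> {} \<longrightarrow> d \<in> F) \<and>
          (act = Drop \<longrightarrow> \<not> b \<and> c > 0) \<and> (act = Pick \<longrightarrow> b)))"

record 's config =
  state :: 's
  pos :: node
  pebbles :: "node set"
  carried :: nat

text \<open>The agent stays put only if no port of its current node is free.\<close>

definition step :: "'s automaton \<Rightarrow> (node \<Rightarrow> port set) \<Rightarrow> 's config \<Rightarrow> 's config" where
  "step A free C =
     (let u = pos C; P = pebbles C; c = carried C in
      case trans A (state C) (free u) (u \<in> P) c of (q, act, d) \<Rightarrow>
        \<lparr> state = q,
          pos = (if d \<in> free u then neighbor u d else u),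
          pebbles = (case act of Keep \<Rightarrow> P | Drop \<Rightarrow> insert u P | Pick \<Rightarrow> P - {u}),
          carried = (case act of Keep \<Rightarrow> c | Drop \<Rightarrow> c - 1 | Pick \<Rightarrow> c + 1) \<rparr>)"

definition initial_config :: "nat \<Rightarrow> 's automaton \<Rightarrow> node \<Rightarrow> 's config" where
  "initial_config p A s = \<lparr> state = init A, pos = s, pebbles = {}, carried = p \<rparr>"

definition run :: "nat \<Rightarrow> 's automaton \<Rightarrow> (node \<Rightarrow> port set) \<Rightarrow> node \<Rightarrow> nat \<Rightarrow> 's config" where
  "run p A free s t = (step A free ^^ t) (initial_config p A s)"

definition explores :: "nat \<Rightarrow> 's automaton \<Rightarrow> (node \<Rightarrow> port set) \<Rightarrow> node set \<Rightarrow> bool" where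
  "explores p A free V \<longleftrightarrow> (\<forall>s\<in>V. \<forall>v\<in>V. \<exists>t. pos (run p A free s t) = v)"

end

theory Submission
  imports Defs
begin

text \<open>
  The nodes of a small wedge are those with \<open>s \<ge> 0\<close> and \<open>t \<ge> 0\<close> for two independent affine
  functions \<open>s\<close> and \<open>t\<close>. Choose a primitive integer vector \<open>w\<close> along which \<open>s\<close> increases and \<open>t\<close>
  decreases. The lines in direction \<open>w\<close> meet the wedge in bounded segments, and their integer
  levels are bounded below. From every node of the wedge, the next higher and some
  lower level (if there is one) can be reached by one of finitely many displacements: this holds
  far from one of the walls, and only finitely many nodes are close to both. For the same reason,
  and because the wedge is connected, two nodes of the wedge that differ by a given displacement
  are joined by a path of bounded length. So an automaton can carry out these displacements by
  trying all short words of ports, undoing a word when it gets blocked: it descends to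
  the lowest level and then sweeps the levels one after the other, without any pebble.
\<close>

subsection \<open>From idling machines to automata\<close>

fun opposite :: "port \<Rightarrow> port" where
  "opposite North = South"
| "opposite East = West"
| "opposite South = North"
| "opposite West = East"

lemma neighbor_opposite [simp]: "neighbor (neighbor u d) (opposite d) = u"
  by (cases u; cases d) simp_all

lemma finite_ports [simp]: "finite (A :: port set)"
proof -
  have "A \<subseteq> {North, East, South, West}"
    using port.exhaust by blast
  then show ?thesis
    by (rule finite_subset) simp
qed

text \<open>Machines without pebbles that may change their state without moving; the search control
  below needs such internal steps.\<close>

definition idle_step ::
  "(node \<Rightarrow> port set) \<Rightarrow> ('s \<Rightarrow> port set \<Rightarrow> 's \<times> port option) \<Rightarrow> 's \<times> node \<Rightarrow> 's \<times> node" where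
  "idle_step free \<delta> C = (case C of (q, u) \<Rightarrow>
     (case \<delta> q (free u) of
        (q', None) \<Rightarrow> (q', u)
      | (q', Some d) \<Rightarrow> (q', if d \<in> free u then neighbor u d else u)))"

text \<open>
  An automaton has to move whenever some port is free. Idling is replaced by
  leaving through an arbitrary free port and coming back, the way back being stored in the state.
\<close>

definition dither ::
  "('s \<Rightarrow> port set \<Rightarrow> 's \<times> port option) \<Rightarrow> 's + port \<times> 's \<Rightarrow> port set \<Rightarrow> ('s + port \<times> 's) \<times> port" where
  "dither \<delta> x F = (let e = (SOME d. d \<in> F) in
     (case x of
        Inl q \<Rightarrow> (case \<delta> q F of (q', r) \<Rightarrow>
          (case r of
             None \<Rightarrow> (if F = {} then Inl q' else Inr (opposite e, q'), e)
           | Some d \<Rightarrow> (if d \<in> F then (Inl q', d)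
                else (if F = {} then Inl q' else Inr (opposite e, q'), e))))
      | Inr (d, q) \<Rightarrow> (Inl q, if d \<in> F then d else e)))"

text \<open>Legality is demanded for all states and port sets, hence also where a stored way back is
  blocked; there the free port \<open>e\<close> is taken instead.\<close>

lemma dither_legal: "F \<noteq> {} \<Longrightarrow> snd (dither \<delta> x F) \<in> F"
  by (auto simp: dither_def Let_def some_in_eq split: sum.splits prod.splits option.splits)

text \<open>One or two steps of the automaton simulate each idling step, so every position of the
  idling machine is also visited. By \<open>sym\<close>, the way back from a detour is free.\<close>

lemma ex_automaton_idle:
  fixes \<delta> :: "'s \<Rightarrow> port set \<Rightarrow> 's \<times> port option"
  assumes "finite S" and "q0 \<in> S" and closed: "\<And>q F. q \<in> S \<Longrightarrow> fst (\<delta> q F) \<in> S"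
    and free: "\<And>u d. u \<in> V \<Longrightarrow> d \<in> free u \<Longrightarrow> neighbor u d \<in> V"
    and sym: "\<And>u d. u \<in> V \<Longrightarrow> d \<in> free u \<Longrightarrow> opposite d \<in> free (neighbor u d)"
  shows "\<exists>A :: nat automaton. pebble_automaton 0 A \<and>
    (\<forall>s\<in>V. \<forall>n. \<exists>t. pos (run 0 A free s t) = snd ((idle_step free \<delta> ^^ n) (q0, s)))"
proof -
  define S' :: "('s + port \<times> 's) set" where "S' = Inl ` S \<union> Inr ` (UNIV \<times> S)"
  have "finite S'" using \<open>finite S\<close> by (simp add: S'_def)
  then obtain enc :: "'s + port \<times> 's \<Rightarrow> nat" where inj: "inj_on enc S'"
    using finite_imp_inj_to_nat_seg by blast
  define dec where "dec = the_inv_into S' enc"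
  have dec: "dec (enc x) = x" if "x \<in> S'" for x
    using the_inv_into_f_f[OF inj that] by (simp add: dec_def)
  have S' [simp]: "Inl q \<in> S' \<longleftrightarrow> q \<in> S" "Inr (d, q) \<in> S' \<longleftrightarrow> q \<in> S" for q d
    by (auto simp: S'_def)
  have closed': "q' \<in> S" if "q \<in> S" "\<delta> q F = (q', r)" for q q' r F
    using closed[OF that(1), of F] that(2) by simp
  have dS: "fst (dither \<delta> x F) \<in> S'" if "x \<in> S'" for x F
    using that
    by (auto simp: dither_def Let_def split: sum.splits prod.splits option.splits
        intro: closed')
  define A :: "nat automaton" where
    "A = \<lparr> states = enc ` S', init = enc (Inl q0),
       trans = (\<lambda>n F b c. (enc (fst (dither \<delta> (dec n) F)), Keep, snd (dither \<delta> (dec n) F))) \<rparr>"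
  have "pebble_automaton 0 A"
    using \<open>finite S'\<close> \<open>q0 \<in> S\<close> dS dec
    by (auto simp: pebble_automaton_def A_def intro!: dither_legal)
  define cfg where "cfg x u = \<lparr> state = enc x, pos = u, pebbles = {}, carried = 0 \<rparr>" for x u
  have st: "step A free (cfg x u) =
      cfg (fst (dither \<delta> x (free u)))
        (if snd (dither \<delta> x (free u)) \<in> free u then neighbor u (snd (dither \<delta> x (free u))) else u)"
    if "x \<in> S'" for x u
    using dec[OF that] by (simp add: step_def cfg_def A_def)
  have sim: "\<exists>k. (step A free ^^ k) (cfg (Inl q) u)
      = cfg (Inl (fst (idle_step free \<delta> (q, u)))) (snd (idle_step free \<delta> (q, u)))"
    if "q \<in> S" "u \<in> V" for q u
  proof -
    obtain q' r where qr: "\<delta> q (free u) = (q', r)" by (rule prod.exhaust)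
    have q': "q' \<in> S" using closed[OF \<open>q \<in> S\<close>] by (metis qr fst_conv)
    have Inl: "Inl q \<in> S'" using that by simp
    show ?thesis
    \<comment> \<open>One step suffices if the requested move is possible, or if no port is free,
      when \<open>step\<close> itself keeps the agent in place. Otherwise the detour takes two
      steps.\<close>
    proof (cases "free u = {} \<or> (\<exists>d\<in>free u. r = Some d)")
      case True
      then have "step A free (cfg (Inl q) u)
        = cfg (Inl (fst (idle_step free \<delta> (q, u)))) (snd (idle_step free \<delta> (q, u)))"
        unfolding st[OF Inl]
        by (auto simp: dither_def Let_def qr idle_step_def split: option.splits)
      then show ?thesis by (intro exI[of _ 1]) simp
    next
      case False
      define e where "e = (SOME d. d \<in> free u)"
      have e: "e \<in> free u" using False by (auto simp: e_def some_in_eq)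
      have "dither \<delta> (Inl q) (free u) = (Inr (opposite e, q'), e)"
        using False by (auto simp: dither_def Let_def qr e_def split: option.splits)
      then have 1: "step A free (cfg (Inl q) u) = cfg (Inr (opposite e, q')) (neighbor u e)"
        using st[OF Inl] e by simp
      have Inr: "Inr (opposite e, q') \<in> S'" using q' by simp
      have "step A free (cfg (Inr (opposite e, q')) (neighbor u e)) = cfg (Inl q') u"
        unfolding st[OF Inr] using sym[OF \<open>u \<in> V\<close> e] by (simp add: dither_def Let_def)
      moreover have "idle_step free \<delta> (q, u) = (q', u)"
        using False by (auto simp: idle_step_def qr split: option.splits)
      ultimately show ?thesis using 1 by (intro exI[of _ "Suc (Suc 0)"]) simp
    qed
  qed
  have inS: "fst ((idle_step free \<delta> ^^ n) (q0, s)) \<in> S \<and> snd ((idle_step free \<delta> ^^ n) (q0, s)) \<in> V"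
    if "s \<in> V" for n s
  proof (induction n)
    case 0 then show ?case using that \<open>q0 \<in> S\<close> by simp
  next
    case (Suc n)
    obtain q u where qu: "(idle_step free \<delta> ^^ n) (q0, s) = (q, u)" by (rule prod.exhaust)
    then have "q \<in> S" "u \<in> V" using Suc by simp_all
    then have "fst (idle_step free \<delta> (q, u)) \<in> S \<and> snd (idle_step free \<delta> (q, u)) \<in> V"
      using free closed' by (auto simp: idle_step_def split: prod.split option.split)
    then show ?case by (simp add: qu)
  qed
  have "\<exists>t. run 0 A free s t = cfg (Inl (fst ((idle_step free \<delta> ^^ n) (q0, s))))
      (snd ((idle_step free \<delta> ^^ n) (q0, s)))" if "s \<in> V" for s n
  proof (induction n)
    case 0
    show ?case by (intro exI[of _ 0]) (simp add: run_def initial_config_def cfg_def A_def)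
  next
    case (Suc n)
    obtain q u where qu: "(idle_step free \<delta> ^^ n) (q0, s) = (q, u)" by (rule prod.exhaust)
    from Suc qu obtain t where t: "run 0 A free s t = cfg (Inl q) u" by auto
    from qu inS[OF that, of n] have "q \<in> S" "u \<in> V" by simp_all
    from sim[OF this] obtain k where k: "(step A free ^^ k) (cfg (Inl q) u)
      = cfg (Inl (fst (idle_step free \<delta> (q, u)))) (snd (idle_step free \<delta> (q, u)))" by blast
    have "run 0 A free s (k + t) = (step A free ^^ k) (run 0 A free s t)"
      by (simp add: run_def funpow_add)
    then show ?case using t k qu by (intro exI[of _ "k + t"]) simp
  qed
  then have "\<forall>s\<in>V. \<forall>n. \<exists>t. pos (run 0 A free s t) = snd ((idle_step free \<delta> ^^ n) (q0, s))"
    by (metis (no_types, lifting) cfg_def config.select_convs(2))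
  with \<open>pebble_automaton 0 A\<close> show ?thesis by blast
qed

subsection \<open>Machines trying words of ports\<close>

fun walk :: "node set \<Rightarrow> node \<Rightarrow> port list \<Rightarrow> bool" where
  "walk V u [] \<longleftrightarrow> True"
| "walk V u (d # ds) \<longleftrightarrow> neighbor u d \<in> V \<and> walk V (neighbor u d) ds"

abbreviation endpoint :: "node \<Rightarrow> port list \<Rightarrow> node" where
  "endpoint \<equiv> foldl neighbor"

lemma endpoint_in: "walk V u ds \<Longrightarrow> u \<in> V \<Longrightarrow> endpoint u ds \<in> V"
  by (induction ds arbitrary: u) auto

lemma walk_append: "walk V u (xs @ ys) \<longleftrightarrow> walk V u xs \<and> walk V (endpoint u xs) ys"
  by (induction xs arbitrary: u) auto

lemma neighbor_add: "neighbor (v + u) d = v + neighbor u d"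
  by (cases v; cases u; cases d) simp_all

lemma endpoint_add: "endpoint (v + u) ds = v + endpoint u ds"
  by (induction ds arbitrary: u) (simp_all add: neighbor_add)

lemma endpoint_shift: "endpoint u ds = u + endpoint 0 ds"
  using endpoint_add[of u 0 ds] by simp

text \<open>An idealized machine that knows beforehand which words can be walked;
  \<open>control_step\<close> replaces this foresight by trial and retreat.\<close>

definition mode_step ::
  "node set \<Rightarrow> ('m \<Rightarrow> port list list) \<Rightarrow> ('m \<Rightarrow> 'm) \<Rightarrow> ('m \<Rightarrow> 'm) \<Rightarrow> 'm \<times> node \<Rightarrow> 'm \<times> node" where
  "mode_step V L yes no C = (case C of (m, u) \<Rightarrow>
     (case find (walk V u) (L m) of
        Some ds \<Rightarrow> (yes m, endpoint u ds)
      | None \<Rightarrow> (no m, u)))"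

text \<open>
  In \<open>Forward m dss ds bs\<close>, the list \<open>ds\<close> is the rest of the word being tried, \<open>bs\<close> is the way back
  to the node where it was started, and \<open>dss\<close> are the words to be tried afterwards.
\<close>

datatype 'm control =
    Select 'm "port list list"
  | Forward 'm "port list list" "port list" "port list"
  | Backward 'm "port list list" "port list"

fun control_step ::
  "('m \<Rightarrow> port list list) \<Rightarrow> ('m \<Rightarrow> 'm) \<Rightarrow> ('m \<Rightarrow> 'm) \<Rightarrow> 'm control \<Rightarrow> port set \<Rightarrow>
     'm control \<times> port option" where
  "control_step L yes no (Select m []) F = (Select (no m) (L (no m)), None)"
| "control_step L yes no (Select m (ds # dss)) F = (Forward m dss ds [], None)"
| "control_step L yes no (Forward m dss [] bs) F = (Select (yes m) (L (yes m)), None)"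
| "control_step L yes no (Forward m dss (d # ds) bs) F =
     (if d \<in> F then (Forward m dss ds (opposite d # bs), Some d) else (Backward m dss bs, None))"
| "control_step L yes no (Backward m dss []) F = (Select m dss, None)"
| "control_step L yes no (Backward m dss (b # bs)) F = (Backward m dss bs, Some b)"

text \<open>In \<open>Forward\<close> only the sum of the lengths is bounded, since every port taken
  passes from \<open>ds\<close> to \<open>bs\<close>. This keeps the set both finite and closed
  under \<open>control_step\<close>.\<close>

definition controls :: "nat \<Rightarrow> nat \<Rightarrow> 'm control set" where
  "controls N R = (let W = {ds. length ds \<le> R}; WW = {dss. set dss \<subseteq> W \<and> length dss \<le> N} in
     (\<lambda>(m, dss). Select m dss) ` (UNIV \<times> WW) \<union>
     (\<lambda>(m, dss, ds, bs). Forward m dss ds bs) `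
        (UNIV \<times> WW \<times> {(ds, bs). length ds + length bs \<le> R}) \<union>
     (\<lambda>(m, dss, bs). Backward m dss bs) ` (UNIV \<times> WW \<times> W))"

lemma Select_controls [simp]: "Select m dss \<in> controls N R \<longleftrightarrow>
    (\<forall>ds\<in>set dss. length ds \<le> R) \<and> length dss \<le> N"
  and Forward_controls [simp]: "Forward m dss ds bs \<in> controls N R \<longleftrightarrow>
    (\<forall>ds\<in>set dss. length ds \<le> R) \<and> length dss \<le> N \<and> length ds + length bs \<le> R"
  and Backward_controls [simp]: "Backward m dss bs \<in> controls N R \<longleftrightarrow>
    (\<forall>ds\<in>set dss. length ds \<le> R) \<and> length dss \<le> N \<and> length bs \<le> R"
  by (auto simp: controls_def Let_def image_iff)

lemma finite_words: "finite {ds :: port list. length ds \<le> R}"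
  using finite_lists_length_le[of "UNIV :: port set" R] by simp

lemma finite_controls:
  assumes "finite (UNIV :: 'm set)"
  shows "finite (controls N R :: 'm control set)"
proof -
  have "{(ds, bs). length ds + length bs \<le> R}
      \<subseteq> {ds :: port list. length ds \<le> R} \<times> {ds :: port list. length ds \<le> R}"
    by auto
  then have "finite {(ds :: port list, bs :: port list). length ds + length bs \<le> R}"
    by (rule finite_subset) (simp add: finite_words)
  then show ?thesis
    using assms finite_words[of R] finite_lists_length_le[OF finite_words[of R], of N]
    by (simp add: controls_def Let_def)
qed

lemma control_step_closed:
  assumes "\<And>m ds. ds \<in> set (L m) \<Longrightarrow> length ds \<le> R" and "\<And>m. length (L m) \<le> N"
    and "q \<in> controls N R"
  shows "fst (control_step L yes no q F) \<in> controls N R"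
  using assms by (cases "(L, yes, no, q, F)" rule: control_step.cases) auto

text \<open>As the free ports are those leading to nodes of \<open>V\<close>, a word gets blocked
  exactly when it would leave \<open>V\<close>. It is then undone, and the next word is tried from
  the same node; so each mode step costs finitely many idling steps.\<close>

lemma ex_automaton_mode:
  fixes L :: "'m \<Rightarrow> port list list"
  assumes "finite (UNIV :: 'm set)"
    and free: "\<And>u d. u \<in> V \<Longrightarrow> d \<in> free u \<longleftrightarrow> neighbor u d \<in> V"
  shows "\<exists>A :: nat automaton. pebble_automaton 0 A \<and>
    (\<forall>s\<in>V. \<forall>n. \<exists>t. pos (run 0 A free s t) = snd ((mode_step V L yes no ^^ n) (m0, s)))"
proof -
  let ?\<delta> = "control_step L yes no"
  let ?step = "idle_step free ?\<delta>"
  define N where "N = Max (range (\<lambda>m. length (L m)))"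
  have N: "length (L m) \<le> N" for m
    unfolding N_def using assms(1) by (intro Max_ge) auto
  have fin: "finite (\<Union>m. set (L m))" using assms(1) by simp
  define R where "R = Max (length ` (\<Union>m. set (L m)))"
  have R: "length ds \<le> R" if "ds \<in> set (L m)" for m ds
    unfolding R_def using fin that by (intro Max_ge) auto
  define reach where "reach x y \<longleftrightarrow> (\<exists>k. (?step ^^ k) x = y)" for x y
  have refl: "reach x x" for x
    unfolding reach_def by (intro exI[of _ 0]) simp
  have trans: "reach x z" if "reach x y" "reach y z" for x y z
    using that unfolding reach_def by (metis comp_apply funpow_add)
  have one: "reach x z" if "reach (?step x) z" for x z
    using that unfolding reach_def by (metis comp_apply funpow_Suc_right)
  \<comment> \<open>Generalized to a word that has been walked in part: \<open>bs\<close> leads from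
    the present node \<open>u\<close> back to the start \<open>v\<close>.\<close>
  have fwd: "reach (Forward m dss ds bs, u)
      (if walk V u ds then (Select (yes m) (L (yes m)), endpoint u ds) else (Select m dss, v))"
    if "u \<in> V" "walk V u bs" "endpoint u bs = v" for m dss ds bs u v
    using that
  proof (induction ds arbitrary: u bs)
    case Nil
    show ?case by (rule one) (simp add: idle_step_def refl)
  next
    case (Cons d ds)
    have bwd: "reach (Backward m dss bs, u) (Select m dss, v)"
      using Cons.prems
    proof (induction bs arbitrary: u)
      case Nil
      show ?case by (rule one) (use Nil in \<open>simp add: idle_step_def refl\<close>)
    next
      case (Cons b bs)
      show ?case by (rule one) (use Cons free in \<open>simp add: idle_step_def\<close>)
    qed
    show ?case
    proof (cases "neighbor u d \<in> V")
      case True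
      then show ?thesis
        using Cons.IH[of "neighbor u d" "opposite d # bs"] Cons.prems free[of u d]
        by (intro one[of "(Forward m dss (d # ds) bs, u)"]) (auto simp: idle_step_def)
    next
      case False
      then show ?thesis
        using bwd free[of u d] Cons.prems
        by (intro one[of "(Forward m dss (d # ds) bs, u)"]) (simp add: idle_step_def)
    qed
  qed
  have sel: "reach (Select m dss, u) (case find (walk V u) dss of
        Some ds \<Rightarrow> (Select (yes m) (L (yes m)), endpoint u ds)
      | None \<Rightarrow> (Select (no m) (L (no m)), u))" if "u \<in> V" for m dss u
  proof (induction dss)
    case Nil
    show ?case by (rule one) (simp add: idle_step_def refl)
  next
    case (Cons ds dss)
    have "reach (Select m (ds # dss), u)
      (if walk V u ds then (Select (yes m) (L (yes m)), endpoint u ds) else (Select m dss, u))"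
      using fwd[OF that, of "[]" u m dss ds]
      by (intro one[of "(Select m (ds # dss), u)"]) (simp add: idle_step_def)
    then show ?case
      by (cases "walk V u ds") (simp_all add: trans[OF _ Cons])
  qed
  have run: "snd ((mode_step V L yes no ^^ n) (m, s)) \<in> V \<and>
     reach (Select m (L m), s) (case (mode_step V L yes no ^^ n) (m, s) of (m', u) \<Rightarrow> (Select m' (L m'), u))"
    if "s \<in> V" for s m n
  proof (induction n)
    case 0 then show ?case using that refl by simp
  next
    case (Suc n)
    obtain m' u where mu: "(mode_step V L yes no ^^ n) (m, s) = (m', u)" by (rule prod.exhaust)
    with Suc have "u \<in> V" and r: "reach (Select m (L m), s) (Select m' (L m'), u)" by simp_all
    have "snd (mode_step V L yes no (m', u)) \<in> V"
      using \<open>u \<in> V\<close> by (auto simp: mode_step_def find_Some_iff intro!: endpoint_in split: option.split)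
    moreover have "reach (Select m (L m), s)
        (case mode_step V L yes no (m', u) of (m', u) \<Rightarrow> (Select m' (L m'), u))"
      using trans[OF r sel[OF \<open>u \<in> V\<close>, of m' "L m'"]]
      by (simp add: mode_step_def split: option.splits)
    ultimately show ?case by (simp add: mu)
  qed
  have sym: "opposite d \<in> free (neighbor u d)" if "u \<in> V" "d \<in> free u" for u d
    using free[OF that(1), of d] free[of "neighbor u d" "opposite d"] that by simp
  have closed: "fst (?\<delta> q F) \<in> controls N R" if "q \<in> controls N R" for q F
    using control_step_closed[of L R N] R N that by blast
  have q0: "Select m0 (L m0) \<in> controls N R" using R N by auto
  obtain A :: "nat automaton" where A: "pebble_automaton 0 A"
      "\<forall>s\<in>V. \<forall>n. \<exists>t. pos (run 0 A free s t) = snd ((?step ^^ n) (Select m0 (L m0), s))"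
    using ex_automaton_idle[OF finite_controls[OF assms(1)] q0, of ?\<delta> V free] closed free sym
    by (metis (no_types, lifting))
  have "\<exists>t. pos (run 0 A free s t) = snd ((mode_step V L yes no ^^ n) (m0, s))" if "s \<in> V" for s n
  proof -
    obtain k where "(?step ^^ k) (Select m0 (L m0), s)
       = (case (mode_step V L yes no ^^ n) (m0, s) of (m', u) \<Rightarrow> (Select m' (L m'), u))"
      using run[OF \<open>s \<in> V\<close>, of n m0] unfolding reach_def by blast
    then have "snd ((?step ^^ k) (Select m0 (L m0), s)) = snd ((mode_step V L yes no ^^ n) (m0, s))"
      by (simp split: prod.splits)
    then show ?thesis using A(2) that by metis
  qed
  with A(1) show ?thesis by blast
qed

subsection \<open>Lattice points of a cone\<close>

text \<open>The determinant makes the linear parts independent, so the region is a pointed cone.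
  Connectedness is assumed because nodes near the apex of a thin cone may be isolated.\<close>

locale cone_nodes =
  fixes s0 s1 s2 t0 t1 t2 :: real and V :: "node set"
  assumes V_eq: "V = {(x, y). s0 + s1 * x + s2 * y \<ge> 0 \<and> t0 + t1 * x + t2 * y \<ge> 0}"
    and det: "s1 * t2 - s2 * t1 > 0"
    and connect: "\<And>u v. u \<in> V \<Longrightarrow> v \<in> V \<Longrightarrow> \<exists>ds. walk V u ds \<and> endpoint u ds = v"
begin

definition ls :: "node \<Rightarrow> real" where "ls v = s1 * fst v + s2 * snd v"
definition lt :: "node \<Rightarrow> real" where "lt v = t1 * fst v + t2 * snd v"

lemma V_iff: "v \<in> V \<longleftrightarrow> s0 + ls v \<ge> 0 \<and> t0 + lt v \<ge> 0"
  by (cases v) (simp add: V_eq ls_def lt_def add.assoc)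

lemma ls_add [simp]: "ls (u + v) = ls u + ls v"
  and lt_add [simp]: "lt (u + v) = lt u + lt v"
  and ls_diff [simp]: "ls (u - v) = ls u - ls v"
  and lt_diff [simp]: "lt (u - v) = lt u - lt v"
  by (simp_all add: ls_def lt_def algebra_simps)

definition scale :: "int \<Rightarrow> node \<Rightarrow> node" where "scale n v = (n * fst v, n * snd v)"

lemma ls_scale [simp]: "ls (scale n v) = n * ls v"
  and lt_scale [simp]: "lt (scale n v) = n * lt v"
  by (simp_all add: ls_def lt_def scale_def algebra_simps)

lemma cramer:
  "(s1 * t2 - s2 * t1) * real_of_int (fst v) = t2 * ls v - s2 * lt v"
  "(s1 * t2 - s2 * t1) * real_of_int (snd v) = s1 * lt v - t1 * ls v"
  by (simp_all add: ls_def lt_def algebra_simps)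

text \<open>By Cramer's rule \<open>ls\<close> and \<open>lt\<close> are coordinates of the plane,
  so bounds on both confine the nodes to a box. These are the nodes close to both walls.\<close>

lemma finite_corner: "finite {v \<in> V. s0 + ls v < C \<and> t0 + lt v < C}"
proof -
  define D where "D = s1 * t2 - s2 * t1"
  have "D > 0" using det by (simp add: D_def)
  define M where "M = \<bar>s0\<bar> + \<bar>t0\<bar> + \<bar>C\<bar>"
  define K where "K = (\<bar>s1\<bar> + \<bar>s2\<bar> + \<bar>t1\<bar> + \<bar>t2\<bar>) * M / D"
  have "\<bar>fst v\<bar> \<le> \<lceil>K\<rceil> \<and> \<bar>snd v\<bar> \<le> \<lceil>K\<rceil>" if "v \<in> V" "s0 + ls v < C" "t0 + lt v < C" for v
  proof -
    have M: "\<bar>ls v\<bar> \<le> M" "\<bar>lt v\<bar> \<le> M"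
      using that by (auto simp: V_iff M_def)
    have "0 \<le> M" by (simp add: M_def)
    have bound: "D * \<bar>z\<bar> \<le> (\<bar>s1\<bar> + \<bar>s2\<bar> + \<bar>t1\<bar> + \<bar>t2\<bar>) * M"
      if "D * z = a * p - b * q" "\<bar>p\<bar> \<le> M" "\<bar>q\<bar> \<le> M" "\<bar>a\<bar> + \<bar>b\<bar> \<le> \<bar>s1\<bar> + \<bar>s2\<bar> + \<bar>t1\<bar> + \<bar>t2\<bar>"
      for z a b p q :: real
    proof -
      have "D * \<bar>z\<bar> = \<bar>a * p - b * q\<bar>"
        using \<open>D > 0\<close> by (simp flip: that(1) add: abs_mult)
      also have "\<dots> \<le> \<bar>a\<bar> * \<bar>p\<bar> + \<bar>b\<bar> * \<bar>q\<bar>"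
        using abs_triangle_ineq4[of "a * p" "b * q"] by (simp add: abs_mult)
      also have "\<dots> \<le> \<bar>a\<bar> * M + \<bar>b\<bar> * M"
        using that by (intro add_mono mult_left_mono) auto
      also have "\<dots> = (\<bar>a\<bar> + \<bar>b\<bar>) * M" by (simp add: distrib_right)
      also have "\<dots> \<le> (\<bar>s1\<bar> + \<bar>s2\<bar> + \<bar>t1\<bar> + \<bar>t2\<bar>) * M"
        using that(4) \<open>0 \<le> M\<close> by (rule mult_right_mono)
      finally show ?thesis .
    qed
    have "D * \<bar>fst v\<bar> \<le> (\<bar>s1\<bar> + \<bar>s2\<bar> + \<bar>t1\<bar> + \<bar>t2\<bar>) * M"
      "D * \<bar>snd v\<bar> \<le> (\<bar>s1\<bar> + \<bar>s2\<bar> + \<bar>t1\<bar> + \<bar>t2\<bar>) * M"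
      using bound[OF cramer(1)[of v, folded D_def] M] bound[OF cramer(2)[of v, folded D_def] M(2,1)]
      by simp_all
    then have "real_of_int \<bar>fst v\<bar> \<le> K" "real_of_int \<bar>snd v\<bar> \<le> K"
      using \<open>D > 0\<close> by (simp_all add: K_def field_simps)
    then show ?thesis by linarith
  qed
  then have "{v \<in> V. s0 + ls v < C \<and> t0 + lt v < C} \<subseteq> {-\<lceil>K\<rceil>..\<lceil>K\<rceil>} \<times> {-\<lceil>K\<rceil>..\<lceil>K\<rceil>}"
    by (force simp: abs_le_iff)
  then show ?thesis by (rule finite_subset) simp
qed

text \<open>Convexity of the cone: an affine function that is nonnegative at both ends of a segment
  is nonnegative in between.\<close>

lemma V_between:
  assumes "u \<in> V" "u + scale n b \<in> V" "0 \<le> k" "k \<le> n"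
  shows "u + scale k b \<in> V"
proof (cases "n = 0")
  case True
  then show ?thesis using assms by simp
next
  case False
  then have n: "n > 0" using assms by simp
  have *: "c + k * x \<ge> 0" if "c \<ge> 0" "c + n * x \<ge> 0" for c x :: real
  proof -
    have "n * (c + k * x) = (n - k) * c + k * (c + n * x)" by (simp add: algebra_simps)
    also have "\<dots> \<ge> 0"
      using mult_nonneg_nonneg[of "real_of_int (n - k)" c]
        mult_nonneg_nonneg[of "real_of_int k" "c + n * x"] that assms(3,4) by simp
    finally have "0 \<le> real_of_int n * (c + k * x)" .
    moreover have "0 < real_of_int n" using n by simp
    ultimately show ?thesis by (metis zero_le_mult_iff not_less)
  qed
  show ?thesis
    using *[of "s0 + ls u" "ls b"] *[of "t0 + lt u" "lt b"] assms
    by (simp add: V_iff add.assoc)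
qed

section \<open>Displacements realized by walks of bounded length\<close>

lemma neighbor_shift: "neighbor u d = u + neighbor 0 d"
  using neighbor_add[of u 0 d] by simp

lemma scale_Suc: "scale (int (Suc n)) b = b + scale (int n) b"
  by (simp add: scale_def prod_eq_iff algebra_simps)

lemma leg:
  assumes "u \<in> V" "u + scale (int n) (neighbor 0 d) \<in> V"
  shows "walk V u (replicate n d) \<and> endpoint u (replicate n d) = u + scale (int n) (neighbor 0 d)"
  using assms
proof (induction n arbitrary: u)
  case 0
  then show ?case by (simp add: scale_def prod_eq_iff)
next
  case (Suc n)
  have "neighbor u d \<in> V"
    using V_between[OF Suc.prems, of 1] by (simp add: scale_def neighbor_shift[of u])
  moreover have eq: "u + scale (int (Suc n)) (neighbor 0 d) = neighbor u d + scale (int n) (neighbor 0 d)"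
    by (simp only: scale_Suc neighbor_shift[of u] add.assoc)
  ultimately show ?case using Suc.IH[of "neighbor u d"] Suc.prems(2) by simp
qed

text \<open>The words depend on \<open>x\<close> and \<open>y\<close> only and serve all nodes
  \<open>u\<close>, which yields a length bound independent of \<open>u\<close>.\<close>

lemma legs:
  obtains dx dy where "\<And>u. u \<in> V \<Longrightarrow> u + (x, 0) \<in> V \<Longrightarrow> walk V u dx \<and> endpoint u dx = u + (x, 0)"
    and "\<And>u. u \<in> V \<Longrightarrow> u + (0, y) \<in> V \<Longrightarrow> walk V u dy \<and> endpoint u dy = u + (0, y)"
proof -
  have "(x, 0) = scale (int (nat \<bar>x\<bar>)) (neighbor 0 (if x \<ge> 0 then East else West))"
    "(0, y) = scale (int (nat \<bar>y\<bar>)) (neighbor 0 (if y \<ge> 0 then North else South))"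
    by (simp_all add: scale_def zero_prod_def)
  then show ?thesis using that leg by metis
qed

text \<open>Outside a corner near the apex, an L-shaped path of two straight legs works. The corner
  is finite, so the walks given by \<open>connect\<close> for its nodes have a greatest
  length.\<close>

lemma walk_displacement:
  "\<exists>R. \<forall>u\<in>V. u + b \<in> V \<longrightarrow> (\<exists>ds. length ds \<le> R \<and> walk V u ds \<and> endpoint u ds = u + b)"
proof -
  define x y where "x = fst b" "y = snd b"
  have b: "(x, 0) + (0, y) = b" "(0, y) + (x, 0) = b" by (simp_all add: x_y_def)
  obtain dx dy where
      dx: "\<And>u. u \<in> V \<Longrightarrow> u + (x, 0) \<in> V \<Longrightarrow> walk V u dx \<and> endpoint u dx = u + (x, 0)"
    and dy: "\<And>u. u \<in> V \<Longrightarrow> u + (0, y) \<in> V \<Longrightarrow> walk V u dy \<and> endpoint u dy = u + (0, y)"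
    using legs[of x y] by blast
  \<comment> \<open>No single leg changes \<open>ls\<close> or \<open>lt\<close> by more than
    \<open>C\<close>, so a node at least that far from a wall does not cross it in one leg.\<close>
  define C where "C = \<bar>ls (x, 0)\<bar> + \<bar>ls (0, y)\<bar> + \<bar>lt (x, 0)\<bar> + \<bar>lt (0, y)\<bar>"
  define F where "F = {v \<in> V. s0 + ls v < C \<and> t0 + lt v < C}"
  have "\<exists>ds. u + b \<in> V \<longrightarrow> walk V u ds \<and> endpoint u ds = u + b" if "u \<in> F" for u
    using connect that by (auto simp: F_def)
  then obtain W where W: "\<And>u. u \<in> F \<Longrightarrow> u + b \<in> V \<Longrightarrow> walk V u (W u) \<and> endpoint u (W u) = u + b"
    by metis
  have "finite F" using finite_corner by (simp add: F_def)
  define R where "R = Max (insert (length dx + length dy) ((length \<circ> W) ` F))"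
  have R: "length dx + length dy \<le> R" "u \<in> F \<Longrightarrow> length (W u) \<le> R" for u
    using \<open>finite F\<close> by (auto simp: R_def intro!: Max_ge)
  have "\<exists>ds. length ds \<le> R \<and> walk V u ds \<and> endpoint u ds = u + b"
    if u: "u \<in> V" and ub: "u + b \<in> V" for u
  proof (cases "u \<in> F")
    case True
    then show ?thesis using W R(2) ub by blast
  next
    case False
    have ls: "ls b = ls (x, 0) + ls (0, y)" and lt: "lt b = lt (x, 0) + lt (0, y)"
      by (simp_all only: ls_add [symmetric] lt_add [symmetric] b)
    \<comment> \<open>Far from one wall, at least one of the two corners between \<open>u\<close> and \<open>u + b\<close> is on the
      inner side of the other wall, as their distances to it have the same sum as those of
      \<open>u\<close> and \<open>u + b\<close>.\<close>
    have "u + (x, 0) \<in> V \<or> u + (0, y) \<in> V"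
      using False u ub unfolding F_def C_def V_iff ls_add lt_add ls lt mem_Collect_eq
      by linarith
    then show ?thesis
    proof
      assume c: "u + (x, 0) \<in> V"
      have e: "u + (x, 0) + (0, y) = u + b" by (simp only: add.assoc b)
      have "walk V u (dx @ dy) \<and> endpoint u (dx @ dy) = u + b"
        using dx[OF u c] dy[OF c] ub e by (simp add: walk_append)
      then show ?thesis using R(1) by (intro exI[of _ "dx @ dy"]) simp
    next
      assume c: "u + (0, y) \<in> V"
      have e: "u + (0, y) + (x, 0) = u + b" by (simp only: add.assoc b)
      have "walk V u (dy @ dx) \<and> endpoint u (dy @ dx) = u + b"
        using dy[OF u c] dx[OF c] ub e by (simp add: walk_append)
      then show ?thesis using R(1) by (intro exI[of _ "dy @ dx"]) simp
    qed
  qed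
  then show ?thesis by blast
qed

lemma walk_displacements:
  assumes "finite B"
  shows "\<exists>R. \<forall>b\<in>B. \<forall>u\<in>V. u + b \<in> V \<longrightarrow> (\<exists>ds. length ds \<le> R \<and> walk V u ds \<and> endpoint u ds = u + b)"
proof -
  obtain R where R: "\<And>b u. u \<in> V \<Longrightarrow> u + b \<in> V \<Longrightarrow>
      \<exists>ds. length ds \<le> R b \<and> walk V u ds \<and> endpoint u ds = u + b"
    using walk_displacement by metis
  have "R b \<le> Max (R ` B)" if "b \<in> B" for b using assms that by simp
  then show ?thesis using R by (meson order_trans)
qed

text \<open>Rounding a large multiple of a real solution.\<close>

lemma ex_int_vector:
  assumes "c \<noteq> 0" "c' \<noteq> 0"
  shows "\<exists>v. ls v * c > 0 \<and> lt v * c' > 0"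
proof -
  define D where "D = s1 * t2 - s2 * t1"
  have "D > 0" using det by (simp add: D_def)
  \<comment> \<open>Rounding both coordinates down changes each linear function by less than
    \<open>N\<close>, so a target value of \<open>N\<close> or \<open>- N\<close> keeps its
    sign.\<close>
  define N where "N = \<bar>s1\<bar> + \<bar>s2\<bar> + \<bar>t1\<bar> + \<bar>t2\<bar> + 1"
  have near: "p * e > 0" if "\<bar>p - N * sgn e\<bar> < N" "e \<noteq> 0" for p e
  proof (cases "e > 0")
    case True
    then have "p > 0" using that(1) by simp
    then show ?thesis using True by simp
  next
    case False
    then have "e < 0" "p < 0" using that by (simp_all add: sgn_if)
    then show ?thesis by (rule mult_neg_neg[rotated])
  qed
  \<comment> \<open>Cramer's rule for the system stated in \<open>xy\<close>.\<close>
  define x y where "x = N * (t2 * sgn c - s2 * sgn c') / D" "y = N * (s1 * sgn c' - t1 * sgn c) / D"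
  have xy: "s1 * x + s2 * y = N * sgn c" "t1 * x + t2 * y = N * sgn c'"
  proof -
    have *: "D * x = N * (t2 * sgn c - s2 * sgn c')" "D * y = N * (s1 * sgn c' - t1 * sgn c)"
      using \<open>D > 0\<close> by (simp_all add: x_y_def)
    have "D * (s1 * x + s2 * y) = s1 * (D * x) + s2 * (D * y)"
      "D * (t1 * x + t2 * y) = t1 * (D * x) + t2 * (D * y)"
      by (simp_all add: distrib_left)
    then have "D * (s1 * x + s2 * y) = D * (N * sgn c)" "D * (t1 * x + t2 * y) = D * (N * sgn c')"
      unfolding * by (simp_all add: D_def algebra_simps)
    then show "s1 * x + s2 * y = N * sgn c" "t1 * x + t2 * y = N * sgn c'"
      using \<open>D > 0\<close> by simp_all
  qed
  have fl: "\<bar>\<lfloor>z\<rfloor> - z\<bar> \<le> 1" for z :: real by linarith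
  have bound: "\<bar>a * \<lfloor>x\<rfloor> + b * \<lfloor>y\<rfloor> - (a * x + b * y)\<bar> \<le> \<bar>a\<bar> + \<bar>b\<bar>" for a b :: real
  proof -
    have "a * \<lfloor>x\<rfloor> + b * \<lfloor>y\<rfloor> - (a * x + b * y) = a * (\<lfloor>x\<rfloor> - x) + b * (\<lfloor>y\<rfloor> - y)"
      by (simp add: algebra_simps)
    also have "\<bar>\<dots>\<bar> \<le> \<bar>a\<bar> * \<bar>\<lfloor>x\<rfloor> - x\<bar> + \<bar>b\<bar> * \<bar>\<lfloor>y\<rfloor> - y\<bar>"
      by (metis abs_mult abs_triangle_ineq)
    also have "\<dots> \<le> \<bar>a\<bar> * 1 + \<bar>b\<bar> * 1"
      by (intro add_mono mult_left_mono fl) auto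
    finally show ?thesis by simp
  qed
  have "\<bar>s1\<bar> + \<bar>s2\<bar> < N" "\<bar>t1\<bar> + \<bar>t2\<bar> < N" by (simp_all add: N_def add_strict_increasing2)
  with bound[of s1 s2] bound[of t1 t2] xy
  have "\<bar>ls (\<lfloor>x\<rfloor>, \<lfloor>y\<rfloor>) - N * sgn c\<bar> < N" "\<bar>lt (\<lfloor>x\<rfloor>, \<lfloor>y\<rfloor>) - N * sgn c'\<bar> < N"
    by (simp_all add: ls_def lt_def)
  with near assms show ?thesis by blast
qed

text \<open>Division by the gcd keeps the signs and makes the vector primitive, so that nodes on a
  common line in its direction differ by integer multiples of it.\<close>

lemma ex_sweep_direction:
  obtains w where "ls w > 0" "lt w < 0" "coprime (fst w) (snd w)"
proof -
  obtain v where v: "ls v > 0" "lt v < 0"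
    using ex_int_vector[of 1 "- 1"] by auto
  define g where "g = gcd (fst v) (snd v)"
  have "v \<noteq> 0" using v by (auto simp: ls_def)
  then have g: "g > 0" by (auto simp: g_def prod_eq_iff)
  define w where "w = (fst v div g, snd v div g)"
  have "v = scale g w" by (simp add: scale_def w_def g_def prod_eq_iff)
  then have "ls w > 0" "lt w < 0"
    using v g by (simp_all add: zero_less_mult_iff mult_less_0_iff)
  moreover have "coprime (fst w) (snd w)"
    using g by (auto simp: w_def g_def intro!: div_gcd_coprime)
  ultimately show ?thesis by (rule that)
qed

end

subsection \<open>Sweeping a cone\<close>

text \<open>\<open>Descend\<close> looks for the lowest level, \<open>Back\<close> runs against
  \<open>w\<close> to the start of a level, \<open>Forth\<close> sweeps it along \<open>w\<close>,
  and \<open>Climb\<close> passes to the next level.\<close>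

datatype mode = Descend | Back | Forth | Climb

text \<open>The first hit in a sorted list has the least key among all hits; this keeps
  \<open>Climb\<close> from skipping a level.\<close>

lemma find_sort_key_le:
  fixes key :: "'a \<Rightarrow> 'b::linorder"
  assumes "find P (sort_key key xs) = Some x" "y \<in> set xs" "P y"
  shows "key x \<le> key y"
proof -
  let ?ys = "sort_key key xs"
  obtain i where i: "i < length ?ys" "?ys ! i = x" "\<forall>j<i. \<not> P (?ys ! j)"
    using assms(1) by (auto simp: find_Some_iff)
  obtain j where j: "j < length ?ys" "?ys ! j = y"
    using assms(2) by (metis in_set_conv_nth set_sort)
  have "i \<le> j" using i(3) j(2) assms(3) not_less by blast
  then have "map key ?ys ! i \<le> map key ?ys ! j"
    using j(1) by (intro sorted_nth_mono) auto
  then show ?thesis using i j by simp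
qed

locale sweep = cone_nodes +
  fixes w :: node
  assumes ls_w: "ls w > 0" and lt_w: "lt w < 0" and coprime_w: "coprime (fst w) (snd w)"
begin

section \<open>Levels along the sweep direction\<close>

text \<open>The determinant of \<open>w\<close> and \<open>v\<close>: an integer linear form that
  numbers the lattice lines in direction \<open>w\<close>.\<close>

definition level :: "node \<Rightarrow> int" where "level v = fst w * snd v - snd w * fst v"

lemma level_add [simp]: "level (u + v) = level u + level v"
  and level_diff [simp]: "level (u - v) = level u - level v"
  and level_minus [simp]: "level (- v) = - level v"
  and level_scale_w [simp]: "level (scale k w) = 0"
  and level_w [simp]: "level w = 0"
  by (simp_all add: level_def scale_def algebra_simps)

text \<open>Determinants are multiplicative under the change of coordinates to \<open>ls\<close> and
  \<open>lt\<close>. Both coefficients \<open>ls w\<close> and \<open>- lt w\<close> are positive,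
  so levels grow away from the walls.\<close>

lemma level_eq: "(s1 * t2 - s2 * t1) * level v = ls w * lt v - lt w * ls v"
  by (simp add: level_def ls_def lt_def algebra_simps)

text \<open>By \<open>level_eq\<close> the level is a positive combination of two functions that are
  bounded below on \<open>V\<close>.\<close>

lemma level_bounded_below: "\<exists>c. \<forall>v\<in>V. c \<le> level v"
proof -
  define D where "D = s1 * t2 - s2 * t1"
  have "D > 0" using det by (simp add: D_def)
  define c where "c = (lt w * s0 - ls w * t0) / D"
  have "\<lfloor>c\<rfloor> \<le> level v" if "v \<in> V" for v
  proof -
    have "0 \<le> ls w * (t0 + lt v)" "lt w * (s0 + ls v) \<le> 0"
      using that ls_w lt_w by (simp_all add: V_iff mult_nonneg_nonneg mult_nonpos_nonneg)
    then have "lt w * s0 - ls w * t0 \<le> D * level v"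
      unfolding D_def level_eq by (simp add: algebra_simps)
    then have "c \<le> level v" using \<open>D > 0\<close> by (simp add: c_def field_simps)
    then show ?thesis by linarith
  qed
  then show ?thesis by blast
qed

text \<open>\<open>w\<close> is primitive, so a Bezout relation for its coordinates expresses the
  multiple as an integer combination of the coordinates of \<open>v - u\<close>.\<close>

lemma same_level:
  assumes "level u = level v"
  shows "\<exists>k. v = u + scale k w"
proof -
  define z where "z = v - u"
  have z: "fst w * snd z = snd w * fst z" using assms by (simp add: z_def level_def algebra_simps)
  obtain a b where ab: "a * fst w + b * snd w = 1"
    using bezout_int[of "fst w" "snd w"] coprime_w by auto
  define k where "k = a * fst z + b * snd z"
  have "k * fst w = a * fst w * fst z + b * (fst w * snd z)" by (simp add: k_def algebra_simps)
  also have "\<dots> = (a * fst w + b * snd w) * fst z" unfolding z by (simp add: algebra_simps)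
  finally have 1: "k * fst w = fst z" using ab by simp
  have "k * snd w = a * (snd w * fst z) + b * snd w * snd z" by (simp add: k_def algebra_simps)
  also have "\<dots> = (a * fst w + b * snd w) * snd z" unfolding z [symmetric] by (simp add: algebra_simps)
  finally have 2: "k * snd w = snd z" using ab by simp
  have "v = u + scale k w" using 1 2 by (simp add: scale_def z_def prod_eq_iff)
  then show ?thesis ..
qed

lemma ex_level_1: "\<exists>z. level z = 1"
proof -
  obtain a b where "a * fst w + b * snd w = 1"
    using bezout_int[of "fst w" "snd w"] coprime_w by auto
  then show ?thesis by (intro exI[of _ "(- b, a)"]) (simp add: level_def algebra_simps)
qed

text \<open>A vector pointing away from both walls never leaves the cone, and it raises the
  level.\<close>

lemma ex_higher:
  assumes "u \<in> V" shows "\<exists>x\<in>V. level u < level x"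
proof -
  obtain p where p: "ls p > 0" "lt p > 0" using ex_int_vector[of 1 1] by auto
  have "0 < ls w * lt p" "lt w * ls p < 0" using p ls_w lt_w by (simp_all add: mult_neg_pos)
  then have "0 < (s1 * t2 - s2 * t1) * level p" unfolding level_eq by simp
  then have "level p > 0" using det by (simp add: zero_less_mult_iff)
  moreover have "u + p \<in> V" using assms p by (simp add: V_iff)
  ultimately show ?thesis by (intro bexI[of _ "u + p"]) simp
qed

text \<open>
  Adding a multiple of \<open>w\<close> to \<open>z\<close> keeps its level but makes it point away from one wall. So it can
  be followed inside \<open>V\<close> far from the other wall.
\<close>

lemma ex_shift:
  "\<exists>C b1 b2. level b1 = level z \<and> level b2 = level z \<and>
     (\<forall>u\<in>V. C \<le> s0 + ls u \<longrightarrow> u + b1 \<in> V) \<and> (\<forall>u\<in>V. C \<le> t0 + lt u \<longrightarrow> u + b2 \<in> V)"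
proof -
  \<comment> \<open>Enough copies of \<open>w\<close> to outweigh \<open>z\<close>: subtracting them
    makes \<open>lt\<close> nonnegative, adding them makes \<open>ls\<close> nonnegative.\<close>
  define m where "m = \<bar>lt z\<bar> / (- lt w) + \<bar>ls z\<bar> / ls w"
  have "\<bar>lt z\<bar> / (- lt w) \<le> m" "\<bar>ls z\<bar> / ls w \<le> m"
    using ls_w lt_w by (simp_all add: m_def divide_nonneg_neg zero_le_divide_iff)
  then have "\<bar>lt z\<bar> / (- lt w) \<le> \<lceil>m\<rceil>" "\<bar>ls z\<bar> / ls w \<le> \<lceil>m\<rceil>" by linarith+
  then have "\<bar>lt z\<bar> \<le> \<lceil>m\<rceil> * (- lt w)" "\<bar>ls z\<bar> \<le> \<lceil>m\<rceil> * ls w"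
    using ls_w lt_w by (simp_all only: pos_divide_le_eq neg_0_less_iff_less)
  then have "lt (z - scale \<lceil>m\<rceil> w) \<ge> 0" "ls (z + scale \<lceil>m\<rceil> w) \<ge> 0" by simp_all
  \<comment> \<open>The constant covers the possible losses: the first displacement can lose only in
    \<open>ls\<close>, the second only in \<open>lt\<close>.\<close>
  then show ?thesis
    by (intro exI[of _ "\<bar>ls (z - scale \<lceil>m\<rceil> w)\<bar> + \<bar>lt (z + scale \<lceil>m\<rceil> w)\<bar>"]
          exI[of _ "z - scale \<lceil>m\<rceil> w"] exI[of _ "z + scale \<lceil>m\<rceil> w"] conjI ballI impI)
       (simp_all add: V_iff del: ls_diff lt_diff ls_scale lt_scale)
qed

text \<open>Far from one of the walls, a displacement of the level of \<open>z\<close> stays in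
  \<open>V\<close> and is good by \<open>P\<close>. For the finitely many other nodes, the
  displacements to chosen good nodes are added to the set.\<close>

lemma ex_near:
  assumes ex: "\<And>u. u \<in> V \<Longrightarrow> Q u \<Longrightarrow> \<exists>x\<in>V. P u x"
    and P: "\<And>u b. u \<in> V \<Longrightarrow> Q u \<Longrightarrow> u + b \<in> V \<Longrightarrow> level b = level z \<Longrightarrow> P u (u + b)"
  shows "\<exists>B. finite B \<and> (\<forall>u\<in>V. Q u \<longrightarrow> (\<exists>b\<in>B. u + b \<in> V \<and> P u (u + b)))"
proof -
  obtain C b1 b2 where b: "level b1 = level z" "level b2 = level z"
      "\<And>u. u \<in> V \<Longrightarrow> C \<le> s0 + ls u \<Longrightarrow> u + b1 \<in> V" "\<And>u. u \<in> V \<Longrightarrow> C \<le> t0 + lt u \<Longrightarrow> u + b2 \<in> V"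
    using ex_shift[of z] by blast
  define F where "F = {v \<in> V. s0 + ls v < C \<and> t0 + lt v < C}"
  obtain X where X: "\<And>u. u \<in> V \<Longrightarrow> Q u \<Longrightarrow> X u \<in> V \<and> P u (X u)" using ex by metis
  define B where "B = insert b1 (insert b2 ((\<lambda>u. X u - u) ` F))"
  have "finite B" using finite_corner by (simp add: B_def F_def)
  moreover have "\<exists>b\<in>B. u + b \<in> V \<and> P u (u + b)" if u: "u \<in> V" "Q u" for u
  proof (cases "u \<in> F")
    case True
    then show ?thesis using X[OF u] by (intro bexI[of _ "X u - u"]) (auto simp: B_def)
  next
    case False
    then have "u + b1 \<in> V \<or> u + b2 \<in> V" using b(3,4)[OF u(1)] u(1) by (auto simp: F_def)
    then show ?thesis
    proof
      assume "u + b1 \<in> V"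
      from P[OF u this b(1)] this show ?thesis by (auto simp: B_def)
    next
      assume "u + b2 \<in> V"
      from P[OF u this b(2)] this show ?thesis by (auto simp: B_def)
    qed
  qed
  ultimately show ?thesis by blast
qed

lemma near_lower:
  "\<exists>B. finite B \<and> (\<forall>u\<in>V. (\<exists>x\<in>V. level x < level u) \<longrightarrow>
     (\<exists>b\<in>B. u + b \<in> V \<and> level (u + b) < level u))"
proof -
  obtain z where "level z = 1" using ex_level_1 by blast
  then show ?thesis by (intro ex_near[where z = "- z"]) simp_all
qed

text \<open>As levels are integers, a displacement of level 1 cannot skip a level; this is the
  generic choice. In the corner, the next occupied level may be higher.\<close>

lemma near_next:
  "\<exists>B. finite B \<and> (\<forall>u\<in>V. \<exists>b\<in>B. u + b \<in> V \<and> level u < level (u + b) \<and>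
     (\<forall>y\<in>V. level u < level y \<longrightarrow> level (u + b) \<le> level y))"
proof -
  obtain z where z: "level z = 1" using ex_level_1 by blast
  have "\<exists>x\<in>V. level u < level x \<and> (\<forall>y\<in>V. level u < level y \<longrightarrow> level x \<le> level y)"
    if u: "u \<in> V" for u
  proof -
    obtain y where "y \<in> V \<and> level u < level y" using ex_higher[OF u] by blast
    from ex_has_least_nat[of "\<lambda>y. y \<in> V \<and> level u < level y" y "\<lambda>y. nat (level y - level u)", OF this]
    obtain x where x: "x \<in> V" "level u < level x"
      "\<forall>y. y \<in> V \<and> level u < level y \<longrightarrow> nat (level x - level u) \<le> nat (level y - level u)" by blast
    have "level x \<le> level y" if "y \<in> V" "level u < level y" for y
    proof -
      have "nat (level x - level u) \<le> nat (level y - level u)" using x(3) that by blast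
      then show ?thesis using that(2) by simp
    qed
    with x show ?thesis by blast
  qed
  then have "\<exists>B. finite B \<and> (\<forall>u\<in>V. True \<longrightarrow> (\<exists>b\<in>B. u + b \<in> V \<and> level u < level (u + b) \<and>
     (\<forall>y\<in>V. level u < level y \<longrightarrow> level (u + b) \<le> level y)))"
    by (intro ex_near[where z = z]) (auto simp: z)
  then show ?thesis by simp
qed

section \<open>The sweeping machine\<close>

text \<open>Each mode tries all words up to length \<open>R\<close> with a suitable effect.
  \<open>R\<close> is chosen so that the failure of all of them proves that no lower level exists,
  or that the segment ends here, which justifies the change of mode.\<close>

lemma ex_exploring_machine:
  "\<exists>(L :: mode \<Rightarrow> port list list) yes no m0. \<forall>s\<in>V. \<forall>v\<in>V. \<exists>n. snd ((mode_step V L yes no ^^ n) (m0, s)) = v"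
proof -
  obtain B1 where B1: "finite B1" "\<And>u x. u \<in> V \<Longrightarrow> x \<in> V \<Longrightarrow> level x < level u \<Longrightarrow>
      \<exists>b\<in>B1. u + b \<in> V \<and> level (u + b) < level u"
    using near_lower by blast
  obtain B2 where B2: "finite B2" "\<And>u. u \<in> V \<Longrightarrow> \<exists>b\<in>B2. u + b \<in> V \<and> level u < level (u + b) \<and>
      (\<forall>y\<in>V. level u < level y \<longrightarrow> level (u + b) \<le> level y)"
    using near_next by blast
  have "finite (insert w (insert (- w) (B1 \<union> B2)))" using B1 B2 by simp
  from walk_displacements[OF this] obtain R where
    R: "\<And>b u. b \<in> insert w (insert (- w) (B1 \<union> B2)) \<Longrightarrow> u \<in> V \<Longrightarrow> u + b \<in> V \<Longrightarrow>
      \<exists>ds. length ds \<le> R \<and> walk V u ds \<and> endpoint u ds = u + b"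
    by blast
  obtain W where W: "set W = {ds :: port list. length ds \<le> R}"
    using finite_list[OF finite_words] by blast
  define disp where "disp ds = endpoint 0 ds" for ds
  have disp: "endpoint u ds = u + disp ds" for u ds
    unfolding disp_def by (rule endpoint_shift)
  define L where "L m = (case m of
      Descend \<Rightarrow> filter (\<lambda>ds. level (disp ds) < 0) W
    | Back \<Rightarrow> filter (\<lambda>ds. disp ds = - w) W
    | Forth \<Rightarrow> filter (\<lambda>ds. disp ds = w) W
    | Climb \<Rightarrow> sort_key (\<lambda>ds. level (disp ds)) (filter (\<lambda>ds. 0 < level (disp ds)) W))" for m
  define yes where "yes m = (case m of Climb \<Rightarrow> Back | _ \<Rightarrow> m)" for m
  define no where "no m = (case m of Descend \<Rightarrow> Back | Back \<Rightarrow> Forth | _ \<Rightarrow> Climb)" for m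
  let ?step = "mode_step V L yes no"
  define reach where "reach x y \<longleftrightarrow> (\<exists>k. (?step ^^ k) x = y)" for x y
  have refl: "reach x x" for x
    unfolding reach_def by (intro exI[of _ 0]) simp
  have trans: "reach x z" if "reach x y" "reach y z" for x y z
    using that unfolding reach_def by (metis comp_apply funpow_add)
  have one: "reach x y" if "?step x = y" for x y
    using that unfolding reach_def by (intro exI[of _ 1]) simp
  have yes: "\<exists>ds\<in>set (L m). walk V u ds \<and> ?step (m, u) = (yes m, u + disp ds) \<and> u + disp ds \<in> V"
    if "u \<in> V" "ds \<in> set (L m)" "walk V u ds" for m u ds
  proof (cases "find (walk V u) (L m)")
    case None
    then show ?thesis using that by (auto simp: find_None_iff)
  next
    case (Some ds')
    then have "ds' \<in> set (L m)" "walk V u ds'" by (auto simp: find_Some_iff)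
    then show ?thesis using endpoint_in[of V u ds'] \<open>u \<in> V\<close>
      by (intro bexI[of _ ds']) (auto simp: mode_step_def Some disp)
  qed
  have no: "?step (m, u) = (no m, u)" if "\<And>ds. ds \<in> set (L m) \<Longrightarrow> \<not> walk V u ds" for m u
  proof -
    have "find (walk V u) (L m) = None" using that by (simp add: find_None_iff)
    then show ?thesis by (simp add: mode_step_def)
  qed
  have word: "\<exists>ds\<in>set W. walk V u ds \<and> disp ds = b"
    if "b \<in> insert w (insert (- w) (B1 \<union> B2))" "u \<in> V" "u + b \<in> V" for b u
    using R[OF that] by (auto simp: W disp)
  obtain c where c: "\<And>v. v \<in> V \<Longrightarrow> c \<le> level v" using level_bounded_below by blast
  \<comment> \<open>Every successful word lowers the level, which is at least \<open>c\<close>;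
    while a lower node exists, some word of length at most \<open>R\<close> reaches one.\<close>
  have to_bottom: "\<exists>x\<in>V. reach (Descend, u) (Back, x) \<and> (\<forall>y\<in>V. level x \<le> level y)" if "u \<in> V" for u
    using that
  proof (induction "nat (level u - c)" arbitrary: u rule: less_induct)
    case less
    show ?case
    proof (cases "\<exists>x\<in>V. level x < level u")
      case True
      then obtain b where b: "b \<in> B1" "u + b \<in> V" "level (u + b) < level u"
        using B1(2) less.prems by blast
      then obtain ds where "ds \<in> set W" "walk V u ds" "disp ds = b" using word[of b u] less.prems by auto
      then have "ds \<in> set (L Descend)" using b(3) by (simp add: L_def)
      from yes[OF less.prems this \<open>walk V u ds\<close>] obtain ds' where ds': "ds' \<in> set (L Descend)"
        "?step (Descend, u) = (Descend, u + disp ds')" "u + disp ds' \<in> V" by (auto simp: yes_def)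
      then have "level (u + disp ds') < level u" by (simp add: L_def)
      then have "nat (level (u + disp ds') - c) < nat (level u - c)"
        using c[OF ds'(3)] by linarith
      from less.hyps[OF this ds'(3)] show ?thesis using trans[OF one[OF ds'(2)]] by blast
    next
      case False
      have "?step (Descend, u) = (no Descend, u)"
      proof (rule no)
        fix ds assume ds: "ds \<in> set (L Descend)"
        show "\<not> walk V u ds"
        proof
          assume "walk V u ds"
          then have "u + disp ds \<in> V" using endpoint_in less.prems disp by metis
          moreover have "level (u + disp ds) < level u" using ds by (simp add: L_def)
          ultimately show False using False by blast
        qed
      qed
      then have "reach (Descend, u) (Back, u)" by (intro one) (simp add: no_def)
      then show ?thesis using False less.prems not_less by blast
    qed
  qed
  \<comment> \<open>All words of these modes have the same displacement \<open>b\<close>, so success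
    or failure decides exactly whether \<open>u + b\<close> lies in \<open>V\<close>.\<close>
  have move: "?step (m, u) = (if u + b \<in> V then (yes m, u + b) else (no m, u))"
    if m: "m = Back \<and> b = - w \<or> m = Forth \<and> b = w" and u: "u \<in> V" for m b u
  proof -
    have L: "ds \<in> set (L m) \<longleftrightarrow> ds \<in> set W \<and> disp ds = b" for ds
      using m by (auto simp: L_def)
    show ?thesis
    proof (cases "u + b \<in> V")
      case True
      then obtain ds where "ds \<in> set W" "walk V u ds" "disp ds = b" using word[of b u] m u by auto
      then show ?thesis using yes[OF u, of ds m] True by (auto simp: L)
    next
      case False
      then have "\<not> walk V u ds" if "ds \<in> set (L m)" for ds
        using endpoint_in[of V u ds] u that by (auto simp: L disp)
      then show ?thesis using no[of m u] False by simp
    qed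
  qed
  \<comment> \<open>The quotient in the induction measure drops by 1 with every step against
    \<open>w\<close> and is nonnegative on \<open>V\<close>.\<close>
  have to_start: "\<exists>x\<in>V. reach (Back, u) (Forth, x) \<and> level x = level u \<and> x - w \<notin> V" if "u \<in> V" for u
    using that
  proof (induction "nat \<lfloor>(s0 + ls u) / ls w\<rfloor>" arbitrary: u rule: less_induct)
    case less
    show ?case
    proof (cases "u - w \<in> V")
      case True
      then have "(s0 + ls (u - w)) / ls w \<ge> 0" using ls_w by (simp add: V_iff)
      moreover have "(s0 + ls (u - w)) / ls w = (s0 + ls u) / ls w - 1"
        using ls_w by (simp add: field_simps)
      ultimately have "nat \<lfloor>(s0 + ls (u - w)) / ls w\<rfloor> < nat \<lfloor>(s0 + ls u) / ls w\<rfloor>" by linarith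
      from less.hyps[OF this True] obtain x where
        x: "x \<in> V" "reach (Back, u - w) (Forth, x)" "level x = level u" "x - w \<notin> V" by auto
      have "?step (Back, u) = (Back, u - w)" using move[of Back "- w" u] less.prems True by (simp add: yes_def)
      from trans[OF one[OF this] x(2)] x show ?thesis by blast
    next
      case False
      have "?step (Back, u) = (Forth, u)" using move[of Back "- w" u] less.prems False by (simp add: no_def)
      from one[OF this] False less.prems show ?thesis by blast
    qed
  qed
  have forth: "reach (Forth, u) (Forth, u + scale (int k) w)" if "u \<in> V" "u + scale (int k) w \<in> V" for u k
    using that
  proof (induction k arbitrary: u)
    case 0
    have "u + scale (int 0) w = u" by (simp add: scale_def prod_eq_iff)
    then show ?case using refl by simp
  next
    case (Suc k)
    have uw: "u + w \<in> V" using V_between[OF Suc.prems, of 1] by (simp add: scale_def)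
    have eq: "u + scale (int (Suc k)) w = u + w + scale (int k) w"
      by (simp only: scale_Suc add.assoc)
    have "reach (Forth, u + w) (Forth, u + scale (int (Suc k)) w)"
      using Suc.IH[OF uw] Suc.prems(2) unfolding eq by blast
    moreover have "?step (Forth, u) = (Forth, u + w)"
      using move[of Forth w u] Suc.prems uw by (simp add: yes_def)
    ultimately show ?case using trans[OF one] by blast
  qed
  \<comment> \<open>The same argument with the other wall, which is approached along
    \<open>w\<close>.\<close>
  have to_end: "\<exists>x\<in>V. reach (Forth, u) (Climb, x) \<and> level x = level u" if "u \<in> V" for u
    using that
  proof (induction "nat \<lfloor>(t0 + lt u) / (- lt w)\<rfloor>" arbitrary: u rule: less_induct)
    case less
    show ?case
    proof (cases "u + w \<in> V")
      case True
      have "- lt w > 0" using lt_w by simp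
      then have "(t0 + lt (u + w)) / (- lt w) \<ge> 0"
        using True unfolding V_iff by (simp only: zero_le_divide_iff) simp
      moreover have "(t0 + lt (u + w)) / (- lt w) = (t0 + lt u) / (- lt w) - 1"
        using lt_w by (simp add: field_simps)
      ultimately have "nat \<lfloor>(t0 + lt (u + w)) / (- lt w)\<rfloor> < nat \<lfloor>(t0 + lt u) / (- lt w)\<rfloor>" by linarith
      from less.hyps[OF this True] obtain x where
        x: "x \<in> V" "reach (Forth, u + w) (Climb, x)" "level x = level u" by auto
      have "?step (Forth, u) = (Forth, u + w)" using move[of Forth w u] less.prems True by (simp add: yes_def)
      from trans[OF one[OF this] x(2)] x show ?thesis by blast
    next
      case False
      have "?step (Forth, u) = (Climb, u)" using move[of Forth w u] less.prems False by (simp add: no_def)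
      from one[OF this] less.prems show ?thesis by blast
    qed
  qed
  have to_next: "\<exists>x\<in>V. reach (Climb, u) (Back, x) \<and> level u < level x \<and>
      (\<forall>y\<in>V. level u < level y \<longrightarrow> level x \<le> level y)" if u: "u \<in> V" for u
  proof -
    obtain b where b: "b \<in> B2" "u + b \<in> V" "level u < level (u + b)"
        "\<forall>y\<in>V. level u < level y \<longrightarrow> level (u + b) \<le> level y"
      using B2(2)[OF u] by blast
    obtain ds where ds: "ds \<in> set W" "walk V u ds" "disp ds = b" using word[of b u] b u by auto
    then have mem: "ds \<in> set (filter (\<lambda>ds. 0 < level (disp ds)) W)" using b(3) by simp
    obtain ds' where ds': "find (walk V u) (L Climb) = Some ds'"
      using ds mem by (cases "find (walk V u) (L Climb)") (auto simp: find_None_iff L_def)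
    then have w': "ds' \<in> set (L Climb)" "walk V u ds'" by (auto simp: find_Some_iff)
    \<comment> \<open>The word for the next level can be walked, so the first success rises no
      higher; its level is positive, so it lands exactly on the next level.\<close>
    have "level (disp ds') \<le> level b"
      using find_sort_key_le[OF ds'[unfolded L_def mode.case] mem ds(2)] ds(3) by simp
    moreover have "0 < level (disp ds')" using w'(1) by (simp add: L_def)
    moreover have "u + disp ds' \<in> V" using endpoint_in[OF w'(2) u] by (simp add: disp)
    moreover have "?step (Climb, u) = (Back, u + disp ds')"
      by (simp add: mode_step_def ds' disp yes_def)
    ultimately show ?thesis using b(4) one by (intro bexI[of _ "u + disp ds'"]) fastforce+
  qed
  have "\<exists>x\<in>V. reach (Descend, s) (Back, x) \<and> level x = level v" if s: "s \<in> V" and "v \<in> V" for s v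
    using \<open>v \<in> V\<close>
  proof (induction "nat (level v - c)" arbitrary: v rule: less_induct)
    case less
    show ?case
    proof (cases "\<exists>y\<in>V. level y < level v")
      case False
      then show ?thesis using to_bottom[OF s] less.prems by (meson antisym_conv not_less)
    next
      case True
      then obtain y where y: "y \<in> V \<and> level y < level v" by blast
      \<comment> \<open>\<open>x\<close> lies on the highest occupied level below \<open>v\<close>.
        One round of \<open>Back\<close>, \<open>Forth\<close> and \<open>Climb\<close> from that
        level ends on the level of \<open>v\<close>.\<close>
      from ex_has_least_nat[of "\<lambda>y. y \<in> V \<and> level y < level v" y "\<lambda>y. nat (level v - level y)", OF this]
      obtain x where x: "x \<in> V" "level x < level v"
        "\<And>y. y \<in> V \<Longrightarrow> level y < level v \<Longrightarrow> nat (level v - level x) \<le> nat (level v - level y)" by blast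
      have "nat (level x - c) < nat (level v - c)" using x(2) c[OF x(1)] by linarith
      from less.hyps[OF this x(1)] obtain x1 where
        1: "x1 \<in> V" "reach (Descend, s) (Back, x1)" "level x1 = level x" by blast
      obtain x2 where 2: "x2 \<in> V" "reach (Back, x1) (Forth, x2)" "level x2 = level x1"
        using to_start[OF 1(1)] by blast
      obtain x3 where 3: "x3 \<in> V" "reach (Forth, x2) (Climb, x3)" "level x3 = level x2"
        using to_end[OF 2(1)] by blast
      obtain x4 where 4: "x4 \<in> V" "reach (Climb, x3) (Back, x4)" "level x3 < level x4"
        "\<forall>y\<in>V. level x3 < level y \<longrightarrow> level x4 \<le> level y"
        using to_next[OF 3(1)] by blast
      have "level x < level x4" "level x4 \<le> level v"
        using 1 2 3 4 less.prems x(2) by simp_all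
      then have "level x4 = level v" using x(3)[OF 4(1)] by (cases "level x4 < level v") auto
      moreover have "reach (Descend, s) (Back, x4)" by (rule trans[OF trans[OF trans[OF 1(2) 2(2)] 3(2)] 4(2)])
      ultimately show ?thesis using 4(1) by blast
    qed
  qed
  moreover have "\<exists>n. snd ((?step ^^ n) (Descend, s)) = v"
    if hyp: "x \<in> V" "v \<in> V" "reach (Descend, s) (Back, x)" "level x = level v" for s v x
  proof -
    obtain u where u: "u \<in> V" "reach (Back, x) (Forth, u)" "level u = level v" "u - w \<notin> V"
      using to_start[OF hyp(1)] hyp(4) by auto
    obtain k where k: "v = u + scale k w" using same_level[OF u(3)] by blast
    \<comment> \<open>Otherwise \<open>u - w\<close> would lie on the segment from \<open>v\<close>
      to \<open>u\<close>, hence in \<open>V\<close> by convexity, but \<open>u\<close> is the start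
      of its level.\<close>
    have "k \<ge> 0"
    proof (rule ccontr)
      assume "\<not> k \<ge> 0"
      have "v + scale (- k) w = u" by (simp add: k scale_def prod_eq_iff)
      then have "v + scale (- k) w \<in> V" using u(1) by simp
      then have "v + scale (- k - 1) w \<in> V"
        using V_between[OF hyp(2), of "- k" w "- k - 1"] \<open>\<not> k \<ge> 0\<close> by simp
      moreover have "v + scale (- k - 1) w = u - w"
        by (simp add: k scale_def prod_eq_iff algebra_simps)
      ultimately show False using u(4) by simp
    qed
    then have "reach (Forth, u) (Forth, v)" using forth[OF u(1), of "nat k"] hyp(2) k by simp
    from trans[OF hyp(3) trans[OF u(2) this]] have "reach (Descend, s) (Forth, v)" .
    then show ?thesis unfolding reach_def by (metis snd_conv)
  qed
  ultimately have "\<forall>s\<in>V. \<forall>v\<in>V. \<exists>n. snd ((?step ^^ n) (Descend, s)) = v" by blast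
  then show ?thesis by blast
qed

end

lemma (in cone_nodes) ex_exploring_automaton:
  assumes free: "\<And>u d. u \<in> V \<Longrightarrow> d \<in> free u \<longleftrightarrow> neighbor u d \<in> V"
  shows "\<exists>A :: nat automaton. pebble_automaton 0 A \<and> explores 0 A free V"
proof -
  obtain w where "ls w > 0" "lt w < 0" "coprime (fst w) (snd w)" by (rule ex_sweep_direction)
  then interpret sweep s0 s1 s2 t0 t1 t2 V w by unfold_locales
  obtain L yes no and m0 :: mode where
    m: "\<forall>s\<in>V. \<forall>v\<in>V. \<exists>n. snd ((mode_step V L yes no ^^ n) (m0, s)) = v"
    using ex_exploring_machine by blast
  have "finite (UNIV :: mode set)"
  proof (rule finite_subset)
    show "UNIV \<subseteq> {Descend, Back, Forth, Climb}" using mode.exhaust by blast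
  qed simp
  from ex_automaton_mode[OF this free, of L yes no m0]
  obtain A :: "nat automaton" where A: "pebble_automaton 0 A"
    "\<forall>s\<in>V. \<forall>n. \<exists>t. pos (run 0 A free s t) = snd ((mode_step V L yes no ^^ n) (m0, s))" by blast
  have "explores 0 A free V"
    unfolding explores_def using m A(2) by metis
  with A(1) show ?thesis by blast
qed

subsection \<open>Small wedges\<close>

text \<open>For an angle below \<pi> the directions are independent, and the law of sines gives the
  coefficients of a direction swept from \<open>d1\<close> to \<open>d2\<close>. Conversely, the
  signs of two sines confine the angle of a nonnegative combination.\<close>

lemma wedge_region_eq:
  assumes "norm d1 = 1" "norm d2 = 1" "small_wedge d1 d2"
  shows "wedge_region a d1 d2 = {a + of_real s * d1 + of_real t * d2 | s t. s \<ge> 0 \<and> t \<ge> 0}"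
proof -
  define \<alpha> where "\<alpha> = cw_angle d1 d2"
  have \<alpha>: "0 < \<alpha>" "\<alpha> < pi" and d2: "d2 = d1 * cis (- \<alpha>)"
    using cw_angle_unique[OF assms(1,2), of \<alpha>] assms(3) by (simp_all add: \<alpha>_def small_wedge_def)
  have sin: "sin \<alpha> > 0" using \<alpha> by (intro sin_gt_zero)
  show ?thesis
  proof (intro equalityI subsetI)
    fix p assume "p \<in> wedge_region a d1 d2"
    then obtain r \<theta> where p: "p = a + of_real r * (d1 * cis (- \<theta>))" "r \<ge> 0" "0 \<le> \<theta>" "\<theta> \<le> \<alpha>"
      by (auto simp: wedge_region_def \<alpha>_def)
    define s t where "s = r * (sin (\<alpha> - \<theta>) / sin \<alpha>)" "t = r * (sin \<theta> / sin \<alpha>)"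
    have "s \<ge> 0" "t \<ge> 0"
      using p(2-4) \<alpha> sin unfolding s_t_def
      by (auto intro!: mult_nonneg_nonneg divide_nonneg_pos sin_ge_zero)
    have "cis (- \<theta>) = of_real (sin (\<alpha> - \<theta>) / sin \<alpha>) + of_real (sin \<theta> / sin \<alpha>) * cis (- \<alpha>)"
      using sin by (simp add: complex_eq_iff sin_diff field_simps)
    then have "p = a + of_real s * d1 + of_real t * d2"
      unfolding p(1) d2 s_t_def by (simp add: algebra_simps)
    then show "p \<in> {a + of_real s * d1 + of_real t * d2 | s t. s \<ge> 0 \<and> t \<ge> 0}"
      using \<open>s \<ge> 0\<close> \<open>t \<ge> 0\<close> by blast
  next
    fix p assume "p \<in> {a + of_real s * d1 + of_real t * d2 | s t. s \<ge> 0 \<and> t \<ge> 0}"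
    then obtain s t where p: "p = a + of_real s * d1 + of_real t * d2" "s \<ge> 0" "t \<ge> 0" by blast
    \<comment> \<open>The conjugate of \<open>(p - a) / d1\<close>: conjugation turns clockwise
      angles into counterclockwise ones, as measured by \<open>Arg2pi\<close>.\<close>
    define z where "z = of_real s + of_real t * cis \<alpha>"
    define r \<theta> where "r = norm z" "\<theta> = (if z = 0 then 0 else Arg2pi z)"
    have z: "z = of_real r * cis \<theta>"
      using Arg2pi_eq[of z] by (simp add: r_\<theta>_def cis_conv_exp)
    have cnj: "of_real s + of_real t * cis (- \<alpha>) = of_real r * cis (- \<theta>)"
      using arg_cong[OF z, of cnj] by (simp add: z_def cis_cnj)
    have "p = a + of_real r * (d1 * cis (- \<theta>))"
      unfolding p(1) d2 using arg_cong[OF cnj, of "\<lambda>x. d1 * x"] by (simp add: algebra_simps)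
    moreover have "0 \<le> \<theta>" using Arg2pi_ge_0 by (simp add: r_\<theta>_def)
    \<comment> \<open>The imaginary part of \<open>z\<close> is nonnegative, so \<theta> is at most
      \<pi>; then \<open>sin (\<theta> - \<alpha>) \<le> 0\<close> excludes a positive
      difference.\<close>
    moreover have "\<theta> \<le> \<alpha>"
    proof (cases "z = 0")
      case True
      then show ?thesis using \<alpha> by (simp add: r_\<theta>_def)
    next
      case False
      then have "r > 0" by (simp add: r_\<theta>_def)
      have "\<theta> < 2 * pi" using Arg2pi_lt_2pi by (simp add: r_\<theta>_def)
      have Re: "s + t * cos \<alpha> = r * cos \<theta>" and Im: "t * sin \<alpha> = r * sin \<theta>"
        using z by (simp_all add: z_def complex_eq_iff)
      have "0 \<le> t * sin \<alpha>" using p(3) sin by simp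
      then have "0 \<le> sin \<theta>" using \<open>r > 0\<close> by (simp add: Im zero_le_mult_iff)
      then have "\<theta> \<le> pi" using sin_lt_zero[of \<theta>] \<open>\<theta> < 2 * pi\<close> by linarith
      have "r * sin (\<theta> - \<alpha>) = (r * sin \<theta>) * cos \<alpha> - (r * cos \<theta>) * sin \<alpha>"
        by (simp add: sin_diff algebra_simps)
      also have "\<dots> = - (s * sin \<alpha>)" by (simp flip: Re Im add: algebra_simps)
      also have "\<dots> \<le> 0" using p(2) sin by simp
      finally have "sin (\<theta> - \<alpha>) \<le> 0" using \<open>r > 0\<close> by (simp add: mult_le_0_iff)
      then show ?thesis using sin_gt_zero[of "\<theta> - \<alpha>"] \<open>\<theta> \<le> pi\<close> \<alpha> by linarith
    qed
    moreover have "r \<ge> 0" by (simp add: r_\<theta>_def)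
    ultimately show "p \<in> wedge_region a d1 d2" unfolding wedge_region_def \<alpha>_def by blast
  qed
qed

text \<open>The signed area spanned by \<open>z\<close> and \<open>z'\<close>, positive if
  \<open>z'\<close> is counterclockwise from \<open>z\<close> by less than \<pi>.\<close>

definition det2 :: "complex \<Rightarrow> complex \<Rightarrow> real" where
  "det2 z z' = Re z * Im z' - Im z * Re z'"

lemma small_wedge_det2:
  assumes "norm d1 = 1" "norm d2 = 1" "small_wedge d1 d2"
  shows "det2 d2 d1 > 0"
proof -
  define \<alpha> where "\<alpha> = cw_angle d1 d2"
  have \<alpha>: "0 < \<alpha>" "\<alpha> < pi" and d2: "d2 = d1 * cis (- \<alpha>)"
    using cw_angle_unique[OF assms(1,2), of \<alpha>] assms(3) by (simp_all add: \<alpha>_def small_wedge_def)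
  have "det2 d2 d1 = sin \<alpha> * ((Re d1)\<^sup>2 + (Im d1)\<^sup>2)"
    by (simp add: det2_def d2 power2_eq_square algebra_simps)
  also have "(Re d1)\<^sup>2 + (Im d1)\<^sup>2 = 1" using assms(1) by (simp add: cmod_def)
  finally show ?thesis using \<alpha> by (simp add: sin_gt_zero)
qed

lemma det2_cramer:
  "of_real (det2 d2 d1) * z = of_real (det2 d2 z) * d1 + of_real (det2 z d1) * d2"
  by (simp add: complex_eq_iff det2_def algebra_simps)

text \<open>By Cramer's rule the two determinants are the coordinates of \<open>p - a\<close> with
  respect to \<open>d2\<close> and \<open>d1\<close>, up to the positive factor
  \<open>det2 d2 d1\<close>.\<close>

lemma wedge_region_iff:
  assumes "norm d1 = 1" "norm d2 = 1" "small_wedge d1 d2"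
  shows "p \<in> wedge_region a d1 d2 \<longleftrightarrow> det2 (p - a) d1 \<ge> 0 \<and> det2 d2 (p - a) \<ge> 0"
proof
  note pos = small_wedge_det2[OF assms]
  assume "p \<in> wedge_region a d1 d2"
  then obtain s t where p: "p = a + of_real s * d1 + of_real t * d2" "s \<ge> 0" "t \<ge> 0"
    unfolding wedge_region_eq[OF assms] by blast
  have "det2 (p - a) d1 = t * det2 d2 d1" "det2 d2 (p - a) = s * det2 d2 d1"
    by (simp_all add: p(1) det2_def algebra_simps)
  then show "det2 (p - a) d1 \<ge> 0 \<and> det2 d2 (p - a) \<ge> 0" using p(2,3) pos by simp
next
  note pos = small_wedge_det2[OF assms]
  assume *: "det2 (p - a) d1 \<ge> 0 \<and> det2 d2 (p - a) \<ge> 0"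
  have "p = a + of_real (det2 d2 (p - a) / det2 d2 d1) * d1 + of_real (det2 (p - a) d1 / det2 d2 d1) * d2"
    using det2_cramer[of d2 d1 "p - a"] pos by (simp add: field_simps)
  moreover have "0 \<le> det2 d2 (p - a) / det2 d2 d1" "0 \<le> det2 (p - a) d1 / det2 d2 d1"
    using * pos by simp_all
  ultimately show "p \<in> wedge_region a d1 d2"
    unfolding wedge_region_eq[OF assms] by blast
qed

lemma in_half_line1:
  assumes "det2 d2 d1 > 0" "det2 (p - a) d1 = 0" "det2 d2 (p - a) \<ge> 0"
  shows "p \<in> half_line a d1"
proof -
  have "p = a + of_real (det2 d2 (p - a) / det2 d2 d1) * d1"
    using det2_cramer[of d2 d1 "p - a"] assms by (simp add: field_simps)
  moreover have "0 \<le> det2 d2 (p - a) / det2 d2 d1" using assms by simp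
  ultimately show ?thesis unfolding half_line_def by blast
qed

lemma in_half_line2:
  assumes "det2 d2 d1 > 0" "det2 (p - a) d1 \<ge> 0" "det2 d2 (p - a) = 0"
  shows "p \<in> half_line a d2"
proof -
  have "p = a + of_real (det2 (p - a) d1 / det2 d2 d1) * d2"
    using det2_cramer[of d2 d1 "p - a"] assms by (simp add: field_simps)
  moreover have "0 \<le> det2 (p - a) d1 / det2 d2 d1" using assms by simp
  ultimately show ?thesis unfolding half_line_def by blast
qed

section \<open>Free ports and walks of the wedge graph\<close>

text \<open>The minimum of the two determinants changes sign along the segment. Where it vanishes,
  one determinant is 0 and the other nonnegative, so the point is on a boundary half-line and not
  merely on the line through it.\<close>

lemma leaving_edge_meets_boundary:
  assumes "norm d1 = 1" "norm d2 = 1" "small_wedge d1 d2"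
    and p: "p \<in> wedge_region a d1 d2" and q: "q \<notin> wedge_region a d1 d2"
  shows "\<exists>H\<in>{half_line a d1, half_line a d2}. H \<inter> closed_segment p q \<noteq> {}"
proof -
  define x where "x l = (1 - l) *\<^sub>R p + l *\<^sub>R q" for l
  define f where "f l = min (det2 (x l - a) d1) (det2 d2 (x l - a))" for l
  have "continuous_on {0..1} f"
    unfolding f_def x_def det2_def by (intro continuous_intros)
  moreover have "f 0 \<ge> 0" "f 1 \<le> 0"
    using p q by (auto simp: f_def x_def wedge_region_iff[OF assms(1-3)])
  ultimately obtain l where l: "0 \<le> l" "l \<le> 1" "f l = 0"
    using IVT2'[of f 1 0 0] by auto
  have "x l \<in> closed_segment p q" using l by (auto simp: x_def closed_segment_def)
  moreover have "x l \<in> half_line a d1 \<or> x l \<in> half_line a d2"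
    using l(3) in_half_line1[OF small_wedge_det2[OF assms(1-3)]]
      in_half_line2[OF small_wedge_det2[OF assms(1-3)]]
    by (auto simp: f_def min_def split: if_splits)
  ultimately show ?thesis by blast
qed

text \<open>Every edge leaving the wedge meets one of the boundaries, both of which are walls, while
  edges inside the wedge are never blocked.\<close>

lemma walled_free_ports_iff:
  assumes "norm d1 = 1" "norm d2 = 1" "small_wedge d1 d2" "u \<in> wedge_nodes a d1 d2"
  shows "d \<in> walled_free_ports a d1 d2 u \<longleftrightarrow> neighbor u d \<in> wedge_nodes a d1 d2"
  using leaving_edge_meets_boundary[OF assms(1-3), of "point u" a "point (neighbor u d)"] assms(4)
  by (auto simp: walled_free_ports_def free_ports_def blocked_edge_def wedge_nodes_def)

text \<open>Every arc of the symmetric closure is a grid edge in one of its orientations, so a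
  directed path in it can be read as a word of ports.\<close>

lemma connected_imp_walk:
  assumes "Digraph_Component.connected (with_proj grid \<restriction> V)" "u \<in> V" "v \<in> V"
  shows "\<exists>ds. walk V u ds \<and> endpoint u ds = v"
proof -
  let ?G = "with_proj (mk_symmetric (with_proj grid \<restriction> V))"
  have arc: "\<exists>d. y = neighbor x d" if "(x, y) \<in> arcs_ends ?G" for x y
  proof -
    have "(x, y) \<in> parcs grid \<or> (y, x) \<in> parcs grid"
      using that by (auto simp: arcs_ends_conv parcs_mk_symmetric)
    then show ?thesis
      unfolding grid_arc_iff by (metis neighbor_opposite)
  qed
  have "u \<rightarrow>\<^sup>*\<^bsub>?G\<^esub> v"
    using assms by (auto simp: connected_def strongly_connected_def)
  then have "(u, v) \<in> rtrancl_on V (arcs_ends ?G)"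
    by (simp add: reachable_def)
  then show ?thesis
  proof (induction rule: rtrancl_on_induct)
    case base
    show ?case by (intro exI[of _ "[]"]) simp
  next
    case (step y z)
    then obtain ds d where "walk V u ds" "endpoint u ds = y" "z = neighbor y d"
      using arc by blast
    then show ?case using \<open>z \<in> V\<close> by (intro exI[of _ "ds @ [d]"]) (simp add: walk_append)
  qed
qed

theorem theorem1:
  fixes a d1 d2 :: complex
  assumes "norm d1 = 1" and "norm d2 = 1"
    and "small_wedge d1 d2"
    and "Digraph_Component.connected (wedge_graph a d1 d2)"
  shows "\<exists>A :: nat automaton. pebble_automaton 0 A \<and>
           explores 0 A (walled_free_ports a d1 d2) (wedge_nodes a d1 d2)"
proof -
  \<comment> \<open>These are the coefficients of \<open>det2 (point v - a) d1\<close> and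
    \<open>det2 d2 (point v - a)\<close> as affine functions of the coordinates of
    \<open>v\<close>.\<close>
  interpret cone_nodes "Re d1 * Im a - Im d1 * Re a" "Im d1" "- Re d1"
    "Re a * Im d2 - Im a * Re d2" "- Im d2" "Re d2" "wedge_nodes a d1 d2"
  proof
    show "wedge_nodes a d1 d2 = {(x, y).
        Re d1 * Im a - Im d1 * Re a + Im d1 * real_of_int x + - Re d1 * real_of_int y \<ge> 0 \<and>
        Re a * Im d2 - Im a * Re d2 + - Im d2 * real_of_int x + Re d2 * real_of_int y \<ge> 0}"
      by (auto simp: wedge_nodes_def wedge_region_iff[OF assms(1-3)] det2_def point_def algebra_simps)
    show "0 < Im d1 * Re d2 - - Re d1 * - Im d2"
      using small_wedge_det2[OF assms(1-3)] by (simp add: det2_def algebra_simps)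
    show "\<exists>ds. walk (wedge_nodes a d1 d2) u ds \<and> endpoint u ds = v"
      if "u \<in> wedge_nodes a d1 d2" "v \<in> wedge_nodes a d1 d2" for u v
      using connected_imp_walk assms(4) that by (simp add: wedge_graph_def)
  qed
  show ?thesis
    by (rule ex_exploring_automaton) (rule walled_free_ports_iff[OF assms(1-3)])
qed

end
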